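(* Let $\alpha\in[0,1]\setminus\mathbb{Q}$ have partial quotients $(\alpha_n)_{n\in\mathbb{N}_0}$ and let $X_\alpha:=\{x\in[0,1]\setminus\mathbb{Q}: x_n\geqslant \alpha_n\ \forall n\in\mathbb{N}_0\}$, where $(x_n)_{n\in\mathbb{N}_0}$ are the partial quotients of $x$. Assume that $\sum_n 1/\alpha_n<\infty$ and let $\gamma_n>0$ be given by $\gamma_n\alpha_n^{\gamma_n}=1$. Then there exists a probability measure $\nu$ on $X_\alpha$ such that for $\nu$-almost every $x\in X_\alpha$ $$\limsup_{n\to\infty}\frac{\sum_{k=0}^{n-1}\left(\gamma_k\log(x_k/\alpha_k)-1\right)}{\sqrt{2n\log\log n}}=1,$$ and such that, furthermore, if $n\ll\alpha_n\ll\lambda^n$ for some $\lambda>1$, or $\lambda^n\ll\alpha_n\ll n^{n(1-\epsilon)}$ for some $\lambda>1$ and $\epsilon>0$, then $\nu$ is absolutely continuous with respect to the $1/2$-dimensional Hausdorff measure $\mu_{1/2}$, the Hausdorff dimension of $X_\alpha$ is $\dim_{H}(X_\alpha)=1/2$, and $\mu_{1/2}(X_\alpha)=\infty$.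
   Context: $\mathbb{N}=\{1,2,\ldots\}$ and $\mathbb{N}_0=\mathbb{N}\cup\{0\}$. The partial quotients $x_0,x_1,\ldots\in\mathbb{N}$ of an irrational $x\in[0,1]$ are the (unique) positive integers with $x=\cfrac{1}{x_0+\cfrac{1}{x_1+\cfrac{1}{x_2+\cdots}}}$. For sequences of positive numbers, $a_n\ll b_n$ means that there is a constant $C$ with $a_n\leqslant Cb_n$ for all $n\geqslant 1$. For each integer $\alpha_n\geqslant1$ the equation $\gamma\,\alpha_n^{\gamma}=1$ has exactly one solution $\gamma=\gamma_n\in(0,1]$. *)

theory Defs
  imports "HOL-Probability.Probability"
begin

section \<open>Partial quotients\<close>

text \<open>\<open>cf_convergent a n\<close> is the finite continued fraction
  \<open>1 / (a 0 + 1 / (a 1 + \<dots> + 1 / a (n - 1)))\<close>; there is no integer part, so the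
  indexing of the partial quotients starts at 0 inside the unit interval.\<close>

fun cf_convergent :: "(nat \<Rightarrow> nat) \<Rightarrow> nat \<Rightarrow> real" where
  "cf_convergent a 0 = 0"
| "cf_convergent a (Suc n) = 1 / (real (a 0) + cf_convergent (\<lambda>k. a (Suc k)) n)"

definition is_cf_expansion :: "(nat \<Rightarrow> nat) \<Rightarrow> real \<Rightarrow> bool" where
  "is_cf_expansion a x \<longleftrightarrow> (\<forall>n. a n \<ge> 1) \<and> cf_convergent a \<longlonglongrightarrow> x"

text \<open>Meaningful for irrational \<open>x\<close> in the unit interval only; see \<open>is_cf_expansion_unique\<close>.\<close>

definition partial_quotients :: "real \<Rightarrow> nat \<Rightarrow> nat" where
  "partial_quotients x = (THE a. is_cf_expansion a x)"

definition cf_bounded_below_set :: "real \<Rightarrow> real set" where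
  "cf_bounded_below_set \<alpha> =
     {x \<in> {0..1} - \<rat>. \<forall>n. partial_quotients x n \<ge> partial_quotients \<alpha> n}"

lemma cf_convergent_nonneg: "cf_convergent a n \<ge> 0"
  by (induction a n rule: cf_convergent.induct) auto

lemma cf_convergent_le_1: "\<forall>n. a n \<ge> 1 \<Longrightarrow> cf_convergent a n \<le> 1"
  by (cases n) (use cf_convergent_nonneg[of "\<lambda>k. a (Suc k)"] in
      \<open>auto simp: divide_simps intro: add_increasing2\<close>)

lemma is_cf_expansion_step:
  assumes "is_cf_expansion a x" "x \<in> {0..1} - \<rat>"
  defines "y \<equiv> 1 / x - real (a 0)"
  shows "is_cf_expansion (\<lambda>k. a (Suc k)) y" "y \<in> {0..1} - \<rat>" "int (a 0) = \<lfloor>1 / x\<rfloor>"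
proof -
  have pos: "\<forall>n. a n \<ge> 1" and lim: "cf_convergent a \<longlonglongrightarrow> x"
    using assms by (auto simp: is_cf_expansion_def)
  have x0: "x \<noteq> 0" using assms(2) by auto
  have "(\<lambda>n. 1 / cf_convergent a (Suc n) - real (a 0)) \<longlonglongrightarrow> y"
    unfolding y_def by (intro tendsto_intros x0 LIMSEQ_Suc lim)
  hence lim': "cf_convergent (\<lambda>k. a (Suc k)) \<longlonglongrightarrow> y" by simp
  show 1: "is_cf_expansion (\<lambda>k. a (Suc k)) y"
    using lim' pos by (auto simp: is_cf_expansion_def)
  have "y \<ge> 0" by (rule LIMSEQ_le_const[OF lim']) (auto intro: cf_convergent_nonneg)
  moreover have "y \<le> 1"
    by (rule LIMSEQ_le_const2[OF lim']) (use pos in \<open>auto intro!: cf_convergent_le_1\<close>)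
  moreover have "y \<notin> \<rat>"
  proof
    assume "y \<in> \<rat>"
    hence "1 / (y + real (a 0)) \<in> \<rat>" by (intro Rats_divide Rats_add) auto
    thus False using x0 assms(2) by (simp add: y_def)
  qed
  ultimately show 2: "y \<in> {0..1} - \<rat>" by auto
  have "y \<noteq> 1" using 2 by auto
  hence "y < 1" using 2 by auto
  thus "int (a 0) = \<lfloor>1 / x\<rfloor>"
    using 2 by (intro floor_unique[symmetric]) (auto simp: y_def)
qed

lemma is_cf_expansion_unique:
  assumes "is_cf_expansion a x" "is_cf_expansion b x" "x \<in> {0..1} - \<rat>"
  shows "a = b"
proof
  fix n show "a n = b n"
    using assms
  proof (induction n arbitrary: a b x)
    case 0
    have "int (a 0) = int (b 0)"
      using is_cf_expansion_step(3)[OF 0(1,3)] is_cf_expansion_step(3)[OF 0(2,3)] by simp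
    thus ?case by simp
  next
    case (Suc n)
    have "int (a 0) = int (b 0)"
      using is_cf_expansion_step(3)[OF Suc.prems(1,3)] is_cf_expansion_step(3)[OF Suc.prems(2,3)]
      by simp
    hence "a 0 = b 0" by simp
    with is_cf_expansion_step[OF Suc.prems(1,3)] is_cf_expansion_step[OF Suc.prems(2,3)]
    show ?case
      using Suc.IH[of "\<lambda>k. a (Suc k)" "1 / x - real (a 0)" "\<lambda>k. b (Suc k)"] by metis
  qed
qed

lemma is_cf_expansion_exists:
  assumes x: "x \<in> {0..1} - \<rat>"
  shows "\<exists>a. is_cf_expansion a x"
proof -
  define T where "T = (\<lambda>x::real. frac (1 / x))"
  define q where "q = (\<lambda>x::real. nat \<lfloor>1 / x\<rfloor>)"
  have T: "T x \<in> {0..1} - \<rat> \<and> q x \<ge> 1 \<and> 1 / x = real (q x) + T x"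
    if "x \<in> {0..1} - \<rat>" for x
  proof -
    have "x \<noteq> 0" using that by auto
    hence x: "0 < x" "x \<le> 1" using that by auto
    hence fl: "\<lfloor>1 / x\<rfloor> \<ge> 1" by (simp add: le_floor_iff)
    have eq: "1 / x = real (q x) + T x"
      using fl unfolding q_def T_def frac_def by linarith
    have "T x \<notin> \<rat>"
    proof
      assume "T x \<in> \<rat>"
      hence "1 / (real (q x) + T x) \<in> \<rat>" by (intro Rats_divide Rats_add) auto
      thus False using that x by (simp flip: eq)
    qed
    moreover have "T x \<ge> 0" "T x \<le> 1"
      unfolding T_def using frac_ge_0[of "1/x"] frac_lt_1[of "1/x"] by linarith+
    moreover have "q x \<ge> 1" using fl unfolding q_def by linarith
    ultimately show ?thesis using eq by simp
  qed
  define a where "a = (\<lambda>x n. q ((T ^^ n) x))"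
  have a_Suc: "(\<lambda>k. a x (Suc k)) = a (T x)" for x
    by (simp add: a_def funpow_swap1)
  have a_0: "a x 0 = q x" for x
    by (simp add: a_def)
  have Tn: "(T ^^ n) x \<in> {0..1} - \<rat>" if "x \<in> {0..1} - \<rat>" for n x
  proof (induction n)
    case (Suc n)
    show ?case using T[OF Suc.IH] by simp
  qed (use that in simp)
  have a_ge: "a x n \<ge> 1" if "x \<in> {0..1} - \<rat>" for x n
    unfolding a_def using T Tn[OF that] by blast
  have diff: "\<bar>1 / (k + s) - 1 / (k + t)\<bar> = \<bar>s - t\<bar> / ((k + s) * (k + t))"
    if "k \<ge> 1" "s \<ge> 0" "t \<ge> 0" for k s t :: real
  proof -
    have "1 / (k + s) - 1 / (k + t) = (t - s) / ((k + s) * (k + t))"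
      using that by (simp add: divide_simps)
    thus ?thesis using that by (simp add: abs_divide abs_minus_commute abs_mult)
  qed
  have le1: "cf_convergent (a x) n \<le> 1" if "x \<in> {0..1} - \<rat>" for x n
    using cf_convergent_le_1 a_ge[OF that] by blast
  have bound: "\<bar>cf_convergent (a x) n - x\<bar> \<le> (1/2) ^ (n div 2)" if "x \<in> {0..1} - \<rat>" for x n
    using that
  proof (induction n arbitrary: x rule: induct_nat_012)
    case (ge2 n)
    define y z where "y = T x" and "z = T y"
    define s where "s = cf_convergent (a z) n"
    define s' where "s' = 1 / (real (q y) + s)"
    have y: "y \<in> {0..1} - \<rat>" "q x \<ge> 1" "1 / x = real (q x) + y" using T[OF ge2.prems] by (simp_all add: y_def)
    have z: "z \<in> {0..1} - \<rat>" "q y \<ge> 1" "1 / y = real (q y) + z" using T[OF y(1)] by (simp_all add: z_def)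
    have s: "s \<ge> 0" by (simp add: s_def cf_convergent_nonneg)
    have s': "s' \<ge> 0" using s by (simp add: s'_def)
    have xeq: "x = 1 / (real (q x) + y)" by (simp flip: y(3))
    have yeq: "y = 1 / (real (q y) + z)" by (simp flip: z(3))
    have conv: "cf_convergent (a x) (Suc (Suc n)) = 1 / (real (q x) + s')"
      unfolding s'_def s_def y_def z_def
      by (simp only: cf_convergent.simps a_Suc a_0)
    have "\<bar>cf_convergent (a x) (Suc (Suc n)) - x\<bar> = \<bar>1 / (real (q x) + s') - 1 / (real (q x) + y)\<bar>"
      using conv xeq by simp
    also have "\<dots> = \<bar>s' - y\<bar> / ((real (q x) + s') * (real (q x) + y))"
      using y s' by (intro diff) auto
    also have "\<bar>s' - y\<bar> = \<bar>1 / (real (q y) + s) - 1 / (real (q y) + z)\<bar>"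
      using yeq by (simp add: s'_def)
    also have "\<dots> = \<bar>s - z\<bar> / ((real (q y) + s) * (real (q y) + z))"
      using z s by (intro diff) auto
    also have "\<bar>s - z\<bar> / ((real (q y) + s) * (real (q y) + z)) / ((real (q x) + s') * (real (q x) + y))
        = \<bar>s - z\<bar> / (((real (q y) + s) * (real (q x) + s')) * ((real (q y) + z) * (real (q x) + y)))"
      by (simp add: mult_ac)
    also have "\<dots> \<le> \<bar>s - z\<bar> / 2"
    proof (rule divide_left_mono)
      have "y \<noteq> 0" using y by auto
      hence "(real (q y) + z) * y = 1" by (simp flip: z(3))
      hence "(real (q y) + z) * (real (q x) + y) = (real (q y) + z) * real (q x) + 1"
        by (simp add: algebra_simps)
      moreover have "(real (q y) + z) * real (q x) \<ge> 1 * 1"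
        using y z by (intro mult_mono) auto
      ultimately have *: "(real (q y) + z) * (real (q x) + y) \<ge> 2" by simp
      have "(real (q y) + s) * (real (q x) + s') \<ge> 1 * 1"
        using y z s s' by (intro mult_mono) auto
      with * have "((real (q y) + s) * (real (q x) + s')) * ((real (q y) + z) * (real (q x) + y)) \<ge> 1 * 2"
        by (intro mult_mono) auto
      thus "2 \<le> ((real (q y) + s) * (real (q x) + s')) * ((real (q y) + z) * (real (q x) + y))" by simp
      thus "0 < (real (q y) + s) * (real (q x) + s') * ((real (q y) + z) * (real (q x) + y)) * 2"
        by simp
    qed auto
    also have "\<dots> \<le> (1/2) ^ (n div 2) / 2"
      using ge2.IH(1)[OF z(1)] by (simp add: s_def)
    finally show ?case by simp
  next
    case 0
    thus ?case by simp
  next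
    case 1
    have "cf_convergent (a x) 1 \<ge> 0" "cf_convergent (a x) 1 \<le> 1"
      using cf_convergent_nonneg le1[OF 1] by blast+
    moreover have "x \<ge> 0" "x \<le> 1" using 1 by auto
    ultimately show ?case by (simp del: cf_convergent.simps)
  qed
  have "filterlim (\<lambda>n::nat. n div 2) at_top at_top"
    by (rule filterlim_at_top_div_const_nat) simp
  from filterlim_compose[OF LIMSEQ_realpow_zero this]
  have "(\<lambda>n. (1/2 :: real) ^ (n div 2)) \<longlonglongrightarrow> 0" by simp
  hence "(\<lambda>n. cf_convergent (a x) n - x) \<longlonglongrightarrow> 0"
    by (rule Lim_null_comparison[rotated]) (use bound[OF x] in \<open>simp add: always_eventually\<close>)
  hence "cf_convergent (a x) \<longlonglongrightarrow> x" by (simp add: LIM_zero_iff)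
  thus ?thesis using a_ge[OF x] by (auto simp: is_cf_expansion_def)
qed

lemma is_cf_expansion_partial_quotients:
  assumes "x \<in> {0..1} - \<rat>"
  shows "is_cf_expansion (partial_quotients x) x"
proof -
  have "\<exists>!a. is_cf_expansion a x"
    using is_cf_expansion_exists[OF assms] is_cf_expansion_unique[OF _ _ assms] by blast
  thus ?thesis unfolding partial_quotients_def by (rule theI')
qed

section \<open>Vinogradov's comparison of sequences\<close>

definition vinogradov_le :: "(nat \<Rightarrow> real) \<Rightarrow> (nat \<Rightarrow> real) \<Rightarrow> bool" (infix "\<lless>" 50) where
  "f \<lless> g \<longleftrightarrow> (\<exists>C. \<forall>n\<ge>1. f n \<le> C * g n)"

section \<open>Hausdorff measure and Hausdorff dimension\<close>

text \<open>The case distinction implements the convention \<open>0\<^sup>0 = 1\<close> for nonempty sets, so that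
  dimension 0 gives the counting measure (in HOL, \<open>0 powr 0 = 0\<close>).\<close>

definition hausdorff_gauge :: "real \<Rightarrow> 'a::metric_space set \<Rightarrow> ennreal" where
  "hausdorff_gauge s U =
     (if U = {} then 0 else if s = 0 then 1 else ennreal (diameter U powr s))"

text \<open>Boundedness has to be required explicitly since \<^const>\<open>diameter\<close> is real-valued and
  unspecified on unbounded sets.\<close>

definition hausdorff_covers :: "real \<Rightarrow> 'a::metric_space set \<Rightarrow> (nat \<Rightarrow> 'a set) set" where
  "hausdorff_covers \<delta> A =
     {U. A \<subseteq> (\<Union>i. U i) \<and> (\<forall>i. bounded (U i) \<and> diameter (U i) \<le> \<delta>)}"

definition hausdorff_premeasure :: "real \<Rightarrow> real \<Rightarrow> 'a::metric_space set \<Rightarrow> ennreal" where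
  "hausdorff_premeasure s \<delta> A = (INF U\<in>hausdorff_covers \<delta> A. \<Sum>i. hausdorff_gauge s (U i))"

definition hausdorff_outer :: "real \<Rightarrow> 'a::metric_space set \<Rightarrow> ennreal" where
  "hausdorff_outer s A = (SUP \<delta>\<in>{0<..}. hausdorff_premeasure s \<delta> A)"

text \<open>The \<open>s\<close>-dimensional Hausdorff measure on the Borel sets; by \<open>emeasure_hausdorff_measure\<close>
  below it agrees there with the outer measure.\<close>

definition hausdorff_measure :: "real \<Rightarrow> 'a::metric_space measure" where
  "hausdorff_measure s = measure_of UNIV (sets borel) (hausdorff_outer s)"

definition hausdorff_dim :: "'a::metric_space set \<Rightarrow> ereal" where
  "hausdorff_dim A = Inf {ereal s | s. s \<ge> 0 \<and> hausdorff_outer s A = 0}"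

lemma hausdorff_gauge_empty [simp]: "hausdorff_gauge s {} = 0"
  by (simp add: hausdorff_gauge_def)

lemma hausdorff_gauge_mono:
  assumes "s \<ge> 0" "U \<subseteq> V" "bounded V"
  shows "hausdorff_gauge s U \<le> hausdorff_gauge s V"
proof -
  have "diameter U powr s \<le> diameter V powr s"
    using assms diameter_subset[OF assms(2,3)] diameter_ge_0[of U] bounded_subset[OF assms(3,2)]
    by (intro powr_mono2) auto
  thus ?thesis using assms(2) by (auto simp: hausdorff_gauge_def intro: ennreal_leI)
qed

lemma hausdorff_premeasure_mono:
  "A \<subseteq> B \<Longrightarrow> hausdorff_premeasure s \<delta> A \<le> hausdorff_premeasure s \<delta> B"
  unfolding hausdorff_premeasure_def
  by (rule INF_superset_mono) (auto simp: hausdorff_covers_def)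

lemma hausdorff_premeasure_antimono:
  "\<delta> \<le> \<delta>' \<Longrightarrow> hausdorff_premeasure s \<delta>' A \<le> hausdorff_premeasure s \<delta> A"
  unfolding hausdorff_premeasure_def
  by (rule INF_superset_mono) (auto simp: hausdorff_covers_def intro: order_trans)

lemma hausdorff_premeasure_le_outer:
  "\<delta> > 0 \<Longrightarrow> hausdorff_premeasure s \<delta> A \<le> hausdorff_outer s A"
  unfolding hausdorff_outer_def by (rule SUP_upper) auto

lemma hausdorff_outer_mono: "A \<subseteq> B \<Longrightarrow> hausdorff_outer s A \<le> hausdorff_outer s B"
  unfolding hausdorff_outer_def by (intro SUP_mono') (rule hausdorff_premeasure_mono)

lemma hausdorff_outer_empty [simp]: "hausdorff_outer s {} = 0"
proof -
  have "hausdorff_premeasure s \<delta> {} \<le> 0" if "\<delta> > 0" for \<delta>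
    unfolding hausdorff_premeasure_def
    by (rule INF_lower2[of "\<lambda>_. {}"]) (use that in \<open>auto simp: hausdorff_covers_def\<close>)
  thus ?thesis unfolding hausdorff_outer_def by (intro antisym SUP_least) auto
qed

lemma hausdorff_premeasure_UN_le:
  "hausdorff_premeasure s \<delta> (\<Union>n. A n) \<le> (\<Sum>n. hausdorff_premeasure s \<delta> (A n))"
proof (rule ennreal_le_epsilon)
  let ?O = "hausdorff_premeasure s \<delta>" and ?f = "hausdorff_gauge s"
  fix e :: real assume "0 < e" "(\<Sum>n. ?O (A n)) < top"
  then have *: "\<And>n. ?O (A n) < ?O (A n) + e * (1/2)^Suc n"
    by (auto simp add: less_top dest!: ennreal_suminf_lessD)
  have "\<exists>B. B \<in> hausdorff_covers \<delta> (A n) \<and> (\<Sum>i. ?f (B i)) \<le> ?O (A n) + e * (1/2)^Suc n" for n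
    using *[of n] unfolding hausdorff_premeasure_def INF_less_iff by (auto intro: less_imp_le)
  then obtain B where B: "\<And>n. B n \<in> hausdorff_covers \<delta> (A n)"
    and Ble: "\<And>n. (\<Sum>i. ?f (B n i)) \<le> ?O (A n) + e * (1/2)^Suc n" by metis
  define C where "C = case_prod B o prod_decode"
  have "C \<in> hausdorff_covers \<delta> (\<Union>n. A n)"
    unfolding hausdorff_covers_def
  proof (intro CollectI conjI allI)
    show "(\<Union>n. A n) \<subseteq> (\<Union>i. C i)"
    proof
      fix x assume "x \<in> (\<Union>n. A n)"
      then obtain n i where "x \<in> B n i" using B unfolding hausdorff_covers_def by blast
      hence "x \<in> C (prod_encode (n, i))" by (simp add: C_def)
      thus "x \<in> (\<Union>i. C i)" by blast
    qed
    fix i show "bounded (C i)" "diameter (C i) \<le> \<delta>"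
      using B unfolding C_def hausdorff_covers_def by (auto simp: split_def)
  qed
  hence "?O (\<Union>n. A n) \<le> (\<Sum>i. ?f (C i))"
    unfolding hausdorff_premeasure_def by (rule INF_lower)
  also have "\<dots> = (\<Sum>n. \<Sum>i. ?f (B n i))"
    unfolding C_def comp_def
    using suminf_ennreal_2dimen[of "\<lambda>n. \<Sum>i. ?f (B n i)" "\<lambda>(n, i). ?f (B n i)"]
    by (simp add: split_def comp_def)
  also have "\<dots> \<le> (\<Sum>n. ?O (A n) + e * (1/2) ^ Suc n)"
    by (intro suminf_le allI Ble) auto
  also have "... = (\<Sum>n. ?O (A n)) + (\<Sum>n. ennreal e * ennreal ((1/2) ^ Suc n))"
    using \<open>0 < e\<close> by (subst suminf_add[symmetric])
                     (auto simp del: ennreal_suminf_cmult simp add: ennreal_mult[symmetric])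
  also have "\<dots> = (\<Sum>n. ?O (A n)) + e"
    unfolding ennreal_suminf_cmult
    by (subst suminf_ennreal_eq[OF zero_le_power power_half_series]) auto
  finally show "?O (\<Union>n. A n) \<le> (\<Sum>n. ?O (A n)) + e" .
qed

lemma hausdorff_outer_UN_le:
  "hausdorff_outer s (\<Union>n. A n) \<le> (\<Sum>n. hausdorff_outer s (A n))"
  unfolding hausdorff_outer_def[of s "\<Union>n. A n"]
proof (rule SUP_least)
  fix \<delta> :: real assume "\<delta> \<in> {0<..}"
  hence "(\<Sum>n. hausdorff_premeasure s \<delta> (A n)) \<le> (\<Sum>n. hausdorff_outer s (A n))"
    by (intro suminf_le hausdorff_premeasure_le_outer) auto
  thus "hausdorff_premeasure s \<delta> (\<Union>n. A n) \<le> (\<Sum>n. hausdorff_outer s (A n))"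
    using hausdorff_premeasure_UN_le order_trans by blast
qed

lemma hausdorff_outer_Un_le:
  "hausdorff_outer s (A \<union> B) \<le> hausdorff_outer s A + hausdorff_outer s B"
proof -
  have "A \<union> B = (\<Union>n. binaryset A B n)" by (simp add: UN_binaryset_eq)
  also have "hausdorff_outer s \<dots> \<le> (\<Sum>n. hausdorff_outer s (binaryset A B n))"
    by (rule hausdorff_outer_UN_le)
  also have "\<dots> = hausdorff_outer s A + hausdorff_outer s B"
    by (rule suminf_binaryset_eq) simp
  finally show ?thesis .
qed

lemma outer_measure_space_hausdorff_outer: "outer_measure_space (Pow UNIV) (hausdorff_outer s)"
  by (auto simp: outer_measure_space_def positive_def increasing_def countably_subadditive_def
      hausdorff_outer_mono hausdorff_outer_UN_le)

lemma hausdorff_outer_separated: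
  assumes s: "s \<ge> 0" and d: "d > 0" "\<And>x y. x \<in> A \<Longrightarrow> y \<in> B \<Longrightarrow> d \<le> dist x y"
  shows "hausdorff_outer s A + hausdorff_outer s B \<le> hausdorff_outer s (A \<union> B)"
proof -
  have *: "hausdorff_premeasure s \<delta> A + hausdorff_premeasure s \<delta> B \<le> hausdorff_premeasure s \<delta> (A \<union> B)"
    if "\<delta> < d" for \<delta>
    unfolding hausdorff_premeasure_def[of s \<delta> "A \<union> B"]
  proof (rule INF_greatest)
    fix U assume U: "U \<in> hausdorff_covers \<delta> (A \<union> B)"
    have bd: "bounded (U i)" "diameter (U i) \<le> \<delta>" for i
      using U by (auto simp: hausdorff_covers_def)
    have sub: "(\<lambda>i. U i \<inter> C) \<in> hausdorff_covers \<delta> C" if "C \<subseteq> A \<union> B" for C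
      unfolding hausdorff_covers_def
    proof (intro CollectI conjI allI)
      show "C \<subseteq> (\<Union>i. U i \<inter> C)" using U that by (auto simp: hausdorff_covers_def)
      fix i show "bounded (U i \<inter> C)" using bd by (simp add: bounded_Int)
      show "diameter (U i \<inter> C) \<le> \<delta>"
        using diameter_subset[of "U i \<inter> C" "U i"] bd[of i] by simp
    qed
    have "hausdorff_premeasure s \<delta> A + hausdorff_premeasure s \<delta> B
        \<le> (\<Sum>i. hausdorff_gauge s (U i \<inter> A)) + (\<Sum>i. hausdorff_gauge s (U i \<inter> B))"
      unfolding hausdorff_premeasure_def using sub[of A] sub[of B]
      by (intro add_mono INF_lower) auto
    also have "\<dots> = (\<Sum>i. hausdorff_gauge s (U i \<inter> A) + hausdorff_gauge s (U i \<inter> B))"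
      by (rule suminf_add) auto
    also have "\<dots> \<le> (\<Sum>i. hausdorff_gauge s (U i))"
    proof (intro suminf_le allI)
      fix i
      have "U i \<inter> A = {} \<or> U i \<inter> B = {}"
      proof (rule ccontr)
        assume "\<not> ?thesis"
        then obtain x y where xy: "x \<in> U i" "x \<in> A" "y \<in> U i" "y \<in> B" by blast
        have "dist x y \<le> diameter (U i)" using bd xy by (intro diameter_bounded_bound)
        with bd(2)[of i] d(2)[OF xy(2,4)] \<open>\<delta> < d\<close> show False by linarith
      qed
      thus "hausdorff_gauge s (U i \<inter> A) + hausdorff_gauge s (U i \<inter> B) \<le> hausdorff_gauge s (U i)"
        using hausdorff_gauge_mono[OF s _ bd(1), of "U i \<inter> A" i]
          hausdorff_gauge_mono[OF s _ bd(1), of "U i \<inter> B" i] by auto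
    qed auto
    finally show "hausdorff_premeasure s \<delta> A + hausdorff_premeasure s \<delta> B
        \<le> (\<Sum>i. hausdorff_gauge s (U i))" .
  qed
  have "hausdorff_premeasure s \<delta> A + hausdorff_premeasure s \<delta>' B \<le> hausdorff_outer s (A \<union> B)"
    if "\<delta> > 0" "\<delta>' > 0" for \<delta> \<delta>'
  proof -
    define \<eta> where "\<eta> = min (min \<delta> \<delta>') (d / 2)"
    have \<eta>: "\<eta> > 0" "\<eta> < d" "\<eta> \<le> \<delta>" "\<eta> \<le> \<delta>'" using that d(1) by (auto simp: \<eta>_def)
    have "hausdorff_premeasure s \<delta> A + hausdorff_premeasure s \<delta>' B
        \<le> hausdorff_premeasure s \<eta> A + hausdorff_premeasure s \<eta> B"
      using \<eta> by (intro add_mono hausdorff_premeasure_antimono)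
    also have "\<dots> \<le> hausdorff_premeasure s \<eta> (A \<union> B)" by (rule *[OF \<eta>(2)])
    also have "\<dots> \<le> hausdorff_outer s (A \<union> B)" by (rule hausdorff_premeasure_le_outer[OF \<eta>(1)])
    finally show ?thesis .
  qed
  hence "hausdorff_premeasure s \<delta> A + hausdorff_outer s B \<le> hausdorff_outer s (A \<union> B)"
    if "\<delta> > 0" for \<delta>
    unfolding hausdorff_outer_def[of s B]
    by (subst ennreal_SUP_add_right) (use that in \<open>auto intro!: SUP_least\<close>)
  thus ?thesis
    unfolding hausdorff_outer_def[of s A]
    by (subst ennreal_SUP_add_left[symmetric]) (auto intro!: SUP_least)
qed

lemma closed_in_lambda_system_hausdorff_outer:
  fixes F :: "'a::metric_space set"
  assumes s: "s \<ge> 0" and F: "closed F"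
  shows "F \<in> lambda_system UNIV (Pow UNIV) (hausdorff_outer s)"
proof -
  let ?f = "hausdorff_outer s"
  have le: "?f (T \<inter> F) + ?f (T - F) \<le> ?f T" if ne: "F \<noteq> {}" and fin: "?f T < top" for T
  proof -
    define E where "E n = {x \<in> T. infdist x F \<ge> 1 / real (Suc n)}" for n
    define D where "D n = E (Suc n) - E n" for n
    have infd: "infdist x F \<le> dist x y + infdist y F" for x y
      using infdist_triangle[of x F y] by (simp add: add.commute)
    have D: "infdist x F < 1 / real (Suc n)" "infdist x F \<ge> 1 / real (Suc (Suc n))" "x \<in> T"
      if "x \<in> D n" for x n
      using that by (auto simp: D_def E_def)
    have sep: "?f (A \<union> B) \<ge> ?f A + ?f B" if "\<And>x. x \<in> A \<Longrightarrow> infdist x F \<ge> u" "\<And>x. x \<in> B \<Longrightarrow> infdist x F \<le> v"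
      "v < u" for A B u v
    proof (rule hausdorff_outer_separated[OF s, of "u - v"])
      fix x y assume "x \<in> A" "y \<in> B"
      thus "u - v \<le> dist x y" using that(1)[of x] that(2)[of y] infd[of x y] by linarith
    qed (use that in auto)
    have stair: "(\<Sum>k<N. ?f (D (2 * k + j))) \<le> ?f (\<Union>k<N. D (2 * k + j))" for N j
    proof (induction N)
      case (Suc N)
      have "?f (\<Union>k<N. D (2 * k + j)) + ?f (D (2 * N + j)) \<le> ?f ((\<Union>k<N. D (2 * k + j)) \<union> D (2 * N + j))"
      proof (cases "N = 0")
        case False
        show ?thesis
        proof (rule sep[of _ "1 / real (2 * N + j)" _ "1 / real (Suc (2 * N + j))"])
          fix x assume "x \<in> (\<Union>k<N. D (2 * k + j))"
          then obtain k where k: "k < N" "x \<in> D (2 * k + j)" by blast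
          have "1 / real (2 * N + j) \<le> 1 / real (Suc (Suc (2 * k + j)))"
            using k(1) by (intro divide_left_mono) auto
          thus "1 / real (2 * N + j) \<le> infdist x F" using D(2)[OF k(2)] by linarith
        next
          fix x assume "x \<in> D (2 * N + j)"
          thus "infdist x F \<le> 1 / real (Suc (2 * N + j))" using D(1) by (intro less_imp_le)
        next
          show "1 / real (Suc (2 * N + j)) < 1 / real (2 * N + j)"
            using False by (intro divide_strict_left_mono) auto
        qed
      qed auto
      moreover have "(\<Union>k<N. D (2 * k + j)) \<union> D (2 * N + j) = (\<Union>k<Suc N. D (2 * k + j))"
        by (auto simp: less_Suc_eq)
      ultimately show ?case using Suc.IH by (auto intro: order_trans add_right_mono)
    qed auto
    have half: "(\<Sum>k<N. ?f (D (2 * k + j))) \<le> ?f T" for N j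
      by (rule order_trans[OF stair hausdorff_outer_mono]) (auto simp: D_def E_def)
    have sum2: "(\<Sum>k<2 * N. ?f (D k)) = (\<Sum>k<N. ?f (D (2 * k + 0))) + (\<Sum>k<N. ?f (D (2 * k + 1)))" for N
      by (induction N) (simp_all add: ac_simps)
    have "(\<Sum>k<N. ?f (D k)) \<le> ?f T + ?f T" for N
    proof -
      have "(\<Sum>k<N. ?f (D k)) \<le> (\<Sum>k<2 * N. ?f (D k))" by (rule sum_mono2) auto
      also have "\<dots> \<le> ?f T + ?f T" unfolding sum2 by (intro add_mono half)
      finally show ?thesis .
    qed
    hence "(\<Sum>k. ?f (D k)) \<le> ?f T + ?f T" by (intro suminf_le_const) auto
    hence Sfin: "(\<Sum>k. ?f (D k)) < top" using fin by (simp add: le_less_trans)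
    show ?thesis
    proof (rule ennreal_le_epsilon)
      fix e :: real assume e: "e > 0"
      have "\<exists>n. (\<Sum>k. ?f (D k)) \<le> (\<Sum>k<n. ?f (D k)) + ennreal e"
      proof (rule ccontr)
        assume "\<not> ?thesis"
        hence "(SUP n. (\<Sum>k<n. ?f (D k)) + ennreal e) \<le> (\<Sum>k. ?f (D k))"
          by (intro SUP_least) (auto simp: not_le intro: less_imp_le)
        also have "(SUP n. (\<Sum>k<n. ?f (D k)) + ennreal e) = (\<Sum>k. ?f (D k)) + ennreal e"
          by (simp add: ennreal_SUP_add_left suminf_eq_SUP)
        finally have "(\<Sum>k. ?f (D k)) + ennreal e \<le> (\<Sum>k. ?f (D k)) + 0" by simp
        thus False using Sfin e unfolding ennreal_add_left_cancel_le by simp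
      qed
      then obtain n where n: "(\<Sum>k. ?f (D k)) \<le> (\<Sum>k<n. ?f (D k)) + ennreal e" by blast
      have split: "(\<Sum>k. ?f (D k)) = (\<Sum>k<n. ?f (D k)) + (\<Sum>k. ?f (D (k + n)))"
        using suminf_offset[of "\<lambda>k. ?f (D k)" n] by (simp add: summableI)
      have "(\<Sum>k<n. ?f (D k)) \<noteq> \<infinity>" using Sfin unfolding split by (metis ennreal_add_eq_top infinity_ennreal_def less_irrefl)
      with n have tail: "(\<Sum>k. ?f (D (k + n))) \<le> ennreal e"
        unfolding split ennreal_add_left_cancel_le by blast
      have "T - F \<subseteq> E n \<union> (\<Union>k. D (k + n))"
      proof
        fix x assume x: "x \<in> T - F"
        hence "infdist x F > 0"
          using in_closed_iff_infdist_zero[OF F ne, of x] infdist_nonneg[of x F] by auto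
        then obtain m where "inverse (real (Suc m)) < infdist x F" using reals_Archimedean by blast
        hence m: "x \<in> E m" using x by (auto simp: E_def inverse_eq_divide)
        have "x \<in> E n \<union> (\<Union>k. D (k + n))" if "x \<in> E (n + l)" for l
          using that
        proof (induction l)
          case (Suc l)
          show ?case
          proof (cases "x \<in> E (n + l)")
            case False
            hence "x \<in> D (l + n)" using Suc.prems by (simp add: D_def add.commute)
            thus ?thesis by blast
          qed (use Suc.IH in blast)
        qed auto
        moreover have "x \<in> E (n + m)"
        proof -
          have "1 / real (Suc (n + m)) \<le> 1 / real (Suc m)" by (intro divide_left_mono) auto
          thus ?thesis using m unfolding E_def mem_Collect_eq by linarith
        qed
        ultimately show "x \<in> E n \<union> (\<Union>k. D (k + n))" by blast
      qed
      hence "?f (T - F) \<le> ?f (E n \<union> (\<Union>k. D (k + n)))" by (rule hausdorff_outer_mono)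
      also have "\<dots> \<le> ?f (E n) + ?f (\<Union>k. D (k + n))" by (rule hausdorff_outer_Un_le)
      also have "\<dots> \<le> ?f (E n) + ennreal e"
        by (intro add_left_mono order_trans[OF hausdorff_outer_UN_le tail])
      finally have "?f (T \<inter> F) + ?f (T - F) \<le> (?f (E n) + ?f (T \<inter> F)) + ennreal e"
        by (metis add.assoc add.commute add_left_mono)
      also have "?f (E n) + ?f (T \<inter> F) \<le> ?f (E n \<union> T \<inter> F)"
        by (rule sep[of _ "1 / real (Suc n)" _ 0]) (auto simp: E_def)
      also have "\<dots> \<le> ?f T" by (intro hausdorff_outer_mono) (auto simp: E_def)
      finally show "?f (T \<inter> F) + ?f (T - F) \<le> ?f T + ennreal e" by (simp add: add_right_mono)
    qed
  qed
  have "?f (T \<inter> F) + ?f (T - F) = ?f T" for T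
  proof (rule antisym)
    show "?f (T \<inter> F) + ?f (T - F) \<le> ?f T"
    proof (cases "F = {} \<or> ?f T = top")
      case False
      thus ?thesis using le[of T] by (simp add: less_top)
    qed auto
    have "T = (T \<inter> F) \<union> (T - F)" by blast
    thus "?f T \<le> ?f (T \<inter> F) + ?f (T - F)" by (metis hausdorff_outer_Un_le)
  qed
  thus ?thesis unfolding algebra.lambda_system_eq[OF algebra_Pow] by simp
qed

lemma measure_space_hausdorff_outer:
  assumes "s \<ge> 0"
  shows "measure_space UNIV (sets (borel :: 'a::metric_space measure)) (hausdorff_outer s)"
proof -
  let ?L = "lambda_system UNIV (Pow UNIV) (hausdorff_outer s :: 'a set \<Rightarrow> ennreal)"
  have L: "measure_space UNIV ?L (hausdorff_outer s)"
    by (rule sigma_algebra.caratheodory_lemma[OF sigma_algebra_Pow outer_measure_space_hausdorff_outer])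
  hence "sigma_algebra UNIV ?L" by (simp add: measure_space_def)
  hence "sigma_sets UNIV (Collect closed) \<subseteq> ?L"
    by (rule sigma_algebra.sigma_sets_subset)
       (use closed_in_lambda_system_hausdorff_outer[OF assms] in blast)
  hence "sets (borel :: 'a measure) \<subseteq> ?L" by (simp add: borel_eq_closed)
  thus ?thesis
    using L sets.sigma_algebra_axioms[of "borel :: 'a measure"]
    by (auto simp: measure_space_def positive_def countably_additive_def subset_iff image_subset_iff)
qed

lemma space_hausdorff_measure [simp]: "space (hausdorff_measure s) = UNIV"
  by (simp add: hausdorff_measure_def space_measure_of_conv)

lemma sets_hausdorff_measure [simp, measurable_cong]: "sets (hausdorff_measure s) = sets borel"
  unfolding hausdorff_measure_def
  using sets.sigma_sets_eq[of borel] by (simp add: sets_measure_of_conv)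

lemma emeasure_hausdorff_measure:
  assumes "s \<ge> 0" "A \<in> sets borel"
  shows "emeasure (hausdorff_measure s) A = hausdorff_outer s A"
  unfolding hausdorff_measure_def
  using measure_space_hausdorff_outer[OF assms(1)] assms(2)
  by (intro emeasure_measure_of_sigma) (auto simp: measure_space_def)

end

theory Submission
  imports Defs "HOL-Real_Asymp.Real_Asymp"
begin

text \<open>The measure is chosen so that the law of the iterated logarithm holds for a deterministic
  reason. Write \<open>g = 1 / \<gamma> k\<close>, so that \<open>\<alpha> k = g powr g\<close>. A digit drawn from
  \<open>[\<alpha> k * exp (s * g), \<alpha> k * exp (t * g)]\<close> with probabilities proportional to \<open>1 / m\<close> contributes an
  increment in \<open>[s - 1, t - 1]\<close> to the sum. Drawing from an interval of positive or of negative
  increments, according to whether the sum so far lies below or above \<open>sqrt (2 n ln (ln n))\<close>, keeps the sum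
  within bounded distance of this target, so the quotient converges to 1.

  Every digit \<open>m\<close> has probability at most \<open>4 / (g * m)\<close> for large \<open>k\<close>. A cylinder has diameter comparable
  to the square of the product of the inverse digits, as \<open>\<Sum>n. 1 / \<alpha> n\<close> converges. Hence the measure of an
  interval is at most the square root of its length, up to the square root of
  \<open>(\<Prod>k<n. 4 / g k)\<^sup>2 * \<alpha> n * exp (2 * g n)\<close>, where \<open>n\<close> is the first index at which the digits vary in the
  interval. This factor tends to 0 in both growth regimes, so the mass distribution principle yields absolute
  continuity and infinite measure. For the upper bound of the dimension, \<open>x \<mapsto> 1 / (m + x)\<close> contracts by
  \<open>1 / m\<^sup>2\<close> and \<open>\<Sum>m\<ge>\<alpha> k. 1 / m powr (2 * s)\<close> tends to 0 for \<open>s > 1/2\<close>.\<close>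

section \<open>Values of infinite continued fractions\<close>

definition cf_value :: "(nat \<Rightarrow> nat) \<Rightarrow> real" where
  "cf_value a = lim (cf_convergent a)"

lemma inverse_shift_diff:
  fixes k s t :: real
  assumes "k + s > 0" "k + t > 0"
  shows "\<bar>1 / (k + s) - 1 / (k + t)\<bar> = \<bar>s - t\<bar> / ((k + s) * (k + t))"
proof -
  have "1 / (k + s) - 1 / (k + t) = (t - s) / ((k + s) * (k + t))"
    using assms by (simp add: divide_simps)
  thus ?thesis using assms by (simp add: abs_divide abs_minus_commute abs_mult)
qed

text \<open>A single inversion need not contract much: for leading digit 1 and tails near 0 its
  factor is close to 1. Over two levels the denominators multiply to (p(q + s) + 1)(p(q + t) + 1),
  which is at least 2 whatever the digits are, so the distance halves on every second level; hence
  \<open>n div 2\<close>.\<close>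

lemma cf_convergent_diff_le:
  assumes "\<forall>k. a k \<ge> 1" "i \<ge> n" "j \<ge> n"
  shows "\<bar>cf_convergent a i - cf_convergent a j\<bar> \<le> (1/2) ^ (n div 2)"
  using assms
proof (induction n arbitrary: a i j rule: induct_nat_012)
  case (ge2 n)
  define b where "b = (\<lambda>k. a (Suc (Suc k)))"
  obtain i' j' where ij: "i = Suc (Suc i')" "i' \<ge> n" "j = Suc (Suc j')" "j' \<ge> n"
    using ge2.prems(2,3) by (metis Suc_le_D Suc_le_mono)
  define s t where "s = cf_convergent b i'" and "t = cf_convergent b j'"
  define p q where "p = real (a 0)" and "q = real (a 1)"
  have nn: "s \<ge> 0" "t \<ge> 0" unfolding s_def t_def by (rule cf_convergent_nonneg)+
  have pq: "p \<ge> 1" "q \<ge> 1" using ge2.prems(1) by (auto simp: p_def q_def)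
  have "\<bar>s - t\<bar> \<le> (1/2) ^ (n div 2)"
    unfolding s_def t_def using ge2.prems(1) ij by (intro ge2.IH) (auto simp: b_def)
  have "\<bar>cf_convergent a i - cf_convergent a j\<bar> = \<bar>1 / (p + 1 / (q + s)) - 1 / (p + 1 / (q + t))\<bar>"
    by (simp add: ij s_def t_def p_def q_def b_def)
  also have "\<dots> = \<bar>1 / (q + s) - 1 / (q + t)\<bar> / ((p + 1 / (q + s)) * (p + 1 / (q + t)))"
    using pq nn by (intro inverse_shift_diff) (auto intro!: add_pos_nonneg)
  also have "\<bar>1 / (q + s) - 1 / (q + t)\<bar> = \<bar>s - t\<bar> / ((q + s) * (q + t))"
    using pq nn by (intro inverse_shift_diff) auto
  also have "\<bar>s - t\<bar> / ((q + s) * (q + t)) / ((p + 1 / (q + s)) * (p + 1 / (q + t)))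
      = \<bar>s - t\<bar> / ((p * (q + s) + 1) * (p * (q + t) + 1))"
  proof -
    have "(q + s) * (q + t) * ((p + 1 / (q + s)) * (p + 1 / (q + t)))
        = ((q + s) * (p + 1 / (q + s))) * ((q + t) * (p + 1 / (q + t)))" by (simp only: mult_ac)
    also have "\<dots> = (p * (q + s) + 1) * (p * (q + t) + 1)"
      using pq nn by (simp add: algebra_simps add_nonneg_eq_0_iff)
    finally show ?thesis by simp
  qed
  also have "\<dots> \<le> \<bar>s - t\<bar> / (2 * 1)"
  proof (rule divide_left_mono)
    have "1 * 1 \<le> p * (q + s)" "1 * 1 \<le> p * (q + t)"
      using pq nn by (intro mult_mono; simp)+
    thus "2 * 1 \<le> (p * (q + s) + 1) * (p * (q + t) + 1)" "0 < (p * (q + s) + 1) * (p * (q + t) + 1) * (2 * 1)"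
      by (intro mult_mono mult_pos_pos; simp)+
  qed auto
  also have "\<dots> \<le> (1/2) ^ (Suc (Suc n) div 2)" using \<open>\<bar>s - t\<bar> \<le> _\<close> by simp
  finally show ?case .
next
  case 0
  show ?case
    using cf_convergent_nonneg[of a i] cf_convergent_le_1[OF 0(1), of i]
      cf_convergent_nonneg[of a j] cf_convergent_le_1[OF 0(1), of j] by simp
next
  case 1
  show ?case
    using cf_convergent_nonneg[of a i] cf_convergent_le_1[OF 1(1), of i]
      cf_convergent_nonneg[of a j] cf_convergent_le_1[OF 1(1), of j] by simp
qed

lemma cf_convergent_tendsto:
  assumes "\<forall>n. a n \<ge> 1"
  shows "cf_convergent a \<longlonglongrightarrow> cf_value a"
proof -
  have "Cauchy (cf_convergent a)"
  proof (rule metric_CauchyI)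
    fix e :: real assume "e > 0"
    then obtain m where m: "(1/2) ^ m < e" using real_arch_pow_inv[of e "1/2"] by auto
    show "\<exists>M. \<forall>i\<ge>M. \<forall>j\<ge>M. dist (cf_convergent a i) (cf_convergent a j) < e"
      using cf_convergent_diff_le[OF assms, of "2 * m"] m
      by (auto simp: dist_real_def intro!: exI[of _ "2 * m"] intro: le_less_trans)
  qed
  thus ?thesis unfolding cf_value_def
    by (simp add: Cauchy_convergent_iff convergent_LIMSEQ_iff)
qed

lemma cf_value_bounds:
  assumes "\<forall>n. a n \<ge> 1"
  shows "0 \<le> cf_value a" "cf_value a \<le> 1"
  using LIMSEQ_le_const[OF cf_convergent_tendsto[OF assms], of 0] cf_convergent_nonneg
    LIMSEQ_le_const2[OF cf_convergent_tendsto[OF assms], of 1] cf_convergent_le_1[OF assms]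
  by auto

lemma cf_value_unfold:
  assumes "\<forall>n. a n \<ge> 1"
  shows "cf_value a = 1 / (real (a 0) + cf_value (\<lambda>k. a (Suc k)))"
proof -
  let ?b = "\<lambda>k. a (Suc k)"
  have b: "\<forall>n. ?b n \<ge> 1" using assms by auto
  have "real (a 0) + cf_value ?b \<noteq> 0"
  proof -
    have "real (a 0) \<ge> 1" using assms by auto
    thus ?thesis using cf_value_bounds(1)[OF b] by linarith
  qed
  hence "(\<lambda>n. 1 / (real (a 0) + cf_convergent ?b n)) \<longlonglongrightarrow> 1 / (real (a 0) + cf_value ?b)"
    by (intro tendsto_intros cf_convergent_tendsto b)
  moreover have "(\<lambda>n. cf_convergent a (Suc n)) \<longlonglongrightarrow> cf_value a"
    by (rule LIMSEQ_Suc[OF cf_convergent_tendsto[OF assms]])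
  ultimately show ?thesis using LIMSEQ_unique by auto
qed

lemma cf_value_in_unit_interval:
  assumes "\<forall>n. a n \<ge> 1"
  shows "0 < cf_value a" "cf_value a < 1"
proof -
  have pos: "0 < cf_value b" if "\<forall>n. b n \<ge> 1" for b
  proof -
    have "real (b 0) + cf_value (\<lambda>k. b (Suc k)) > 0"
      using cf_value_bounds(1)[of "\<lambda>k. b (Suc k)"] that by (intro add_pos_nonneg) (auto simp: Suc_le_eq)
    thus ?thesis by (subst cf_value_unfold[OF that]) simp
  qed
  show "0 < cf_value a" by (rule pos[OF assms])
  have "real (a 0) \<ge> 1" using assms by auto
  moreover have "cf_value (\<lambda>k. a (Suc k)) > 0" using assms by (intro pos) auto
  ultimately have "1 / (real (a 0) + cf_value (\<lambda>k. a (Suc k))) < 1" by (simp add: divide_simps)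
  thus "cf_value a < 1" by (subst cf_value_unfold[OF assms])
qed

text \<open>Descent on the denominator: if \<open>x = p / q\<close> then \<open>1 / x - a 0\<close> has denominator \<open>p < q\<close>.\<close>

lemma cf_value_irrational:
  assumes "\<forall>n. a n \<ge> 1"
  shows "cf_value a \<notin> \<rat>"
proof
  assume "cf_value a \<in> \<rat>"
  then obtain p :: int and q :: nat where "q > 0" "cf_value a = of_int p / of_nat q"
    by (elim Rats_cases') (metis of_int_of_nat_eq zero_less_imp_eq_int of_nat_0_less_iff)
  thus False using assms
  proof (induction q arbitrary: a p rule: less_induct)
    case (less q)
    let ?b = "\<lambda>k. a (Suc k)"
    have b: "\<forall>n. ?b n \<ge> 1" using less.prems by auto
    have x: "0 < of_int p / real q" "of_int p / real q < 1"
      using cf_value_in_unit_interval[OF less.prems(3)] less.prems(2) by auto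
    hence p: "0 < p" "p < int q" using less.prems(1)
      by (auto simp: zero_less_divide_iff divide_simps)
    have "real (a 0) + cf_value ?b = 1 / cf_value a"
      unfolding cf_value_unfold[OF less.prems(3)] by simp
    also have "\<dots> = real q / of_int p" using less.prems(2) by simp
    finally have "cf_value ?b = of_int (int q - p * int (a 0)) / real (nat p)"
      using p by (simp add: field_simps)
    moreover have "nat p < q" "0 < nat p" using p by auto
    ultimately show False using less.IH b by blast
  qed
qed

lemma cf_value_mem:
  "\<forall>n. a n \<ge> 1 \<Longrightarrow> cf_value a \<in> {0..1} - \<rat>"
  using cf_value_bounds cf_value_irrational by auto

lemma partial_quotients_cf_value:
  assumes "\<forall>n. a n \<ge> 1"
  shows "partial_quotients (cf_value a) = a"
  by (rule is_cf_expansion_unique[OF is_cf_expansion_partial_quotients])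
     (use assms cf_value_mem cf_convergent_tendsto in \<open>auto simp: is_cf_expansion_def\<close>)

lemma cf_value_partial_quotients:
  assumes "x \<in> {0..1} - \<rat>"
  shows "cf_value (partial_quotients x) = x"
  using is_cf_expansion_partial_quotients[OF assms]
  by (auto simp: is_cf_expansion_def cf_value_def limI)

lemma partial_quotients_ge_1:
  "x \<in> {0..1} - \<rat> \<Longrightarrow> partial_quotients x n \<ge> 1"
  using is_cf_expansion_partial_quotients by (auto simp: is_cf_expansion_def)

lemma cf_bounded_below_set_eq:
  assumes "\<alpha> \<in> {0..1} - \<rat>"
  shows "cf_bounded_below_set \<alpha> = cf_value ` {b. \<forall>n. b n \<ge> partial_quotients \<alpha> n}"
proof (intro set_eqI iffI)
  fix x assume "x \<in> cf_value ` {b. \<forall>n. b n \<ge> partial_quotients \<alpha> n}"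
  then obtain b where b: "x = cf_value b" "\<forall>n. b n \<ge> partial_quotients \<alpha> n" by auto
  have "\<forall>n. b n \<ge> 1" using b(2) partial_quotients_ge_1[OF assms] order_trans by blast
  thus "x \<in> cf_bounded_below_set \<alpha>"
    using b cf_value_mem[of b] partial_quotients_cf_value[of b] by (auto simp: cf_bounded_below_set_def)
next
  fix x assume "x \<in> cf_bounded_below_set \<alpha>"
  thus "x \<in> cf_value ` {b. \<forall>n. b n \<ge> partial_quotients \<alpha> n}"
    using cf_value_partial_quotients[of x]
    by (auto simp: cf_bounded_below_set_def intro!: rev_image_eqI[of "partial_quotients x"])
qed

text \<open>Both tails lie in (0,1), so neither denominator exceeds \<open>a 0 + 1\<close>. This
  limits how strongly a common digit contracts; iterated, it keeps points apart whose digits first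
  differ at a given index.\<close>

lemma cf_value_diff_same_head:
  assumes "\<forall>n. a n \<ge> 1" "\<forall>n. b n \<ge> 1" "a 0 = b 0"
  defines "d \<equiv> \<bar>cf_value (\<lambda>k. a (Suc k)) - cf_value (\<lambda>k. b (Suc k))\<bar>"
  shows "d / (real (a 0) + 1)\<^sup>2 \<le> \<bar>cf_value a - cf_value b\<bar>"
proof -
  define s t where "s = cf_value (\<lambda>k. a (Suc k))" and "t = cf_value (\<lambda>k. b (Suc k))"
  have st: "0 < s" "s < 1" "0 < t" "t < 1"
    using cf_value_in_unit_interval[of "\<lambda>k. a (Suc k)"] cf_value_in_unit_interval[of "\<lambda>k. b (Suc k)"] assms
    by (auto simp: s_def t_def)
  have a0: "real (a 0) \<ge> 1" using assms(1) by auto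
  have eq: "\<bar>cf_value a - cf_value b\<bar> = \<bar>s - t\<bar> / ((real (a 0) + s) * (real (a 0) + t))"
    unfolding cf_value_unfold[OF assms(1)] cf_value_unfold[OF assms(2)] assms(3)[symmetric] s_def[symmetric] t_def[symmetric]
    using a0 st by (intro inverse_shift_diff) auto
  have "\<bar>s - t\<bar> / (real (a 0) + 1)\<^sup>2 \<le> \<bar>s - t\<bar> / ((real (a 0) + s) * (real (a 0) + t))"
    unfolding power2_eq_square using a0 st
    by (intro divide_left_mono mult_mono mult_pos_pos) auto
  thus "d / (real (a 0) + 1)\<^sup>2 \<le> \<bar>cf_value a - cf_value b\<bar>"
    unfolding eq by (simp add: d_def s_def t_def)
qed

lemma cf_value_diff_same_prefix:
  assumes "\<forall>n. a n \<ge> 1" "\<forall>n. b n \<ge> 1" "\<forall>k<n. a k = b k"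
  shows "\<bar>cf_value (\<lambda>k. a (n + k)) - cf_value (\<lambda>k. b (n + k))\<bar> / (\<Prod>k<n. (real (a k) + 1)\<^sup>2)
    \<le> \<bar>cf_value a - cf_value b\<bar>"
  using assms
proof (induction n arbitrary: a b)
  case (Suc n)
  let ?a = "\<lambda>k. a (Suc k)" and ?b = "\<lambda>k. b (Suc k)"
  have "\<bar>cf_value (\<lambda>k. a (Suc n + k)) - cf_value (\<lambda>k. b (Suc n + k))\<bar> / (\<Prod>k<Suc n. (real (a k) + 1)\<^sup>2)
    = (\<bar>cf_value (\<lambda>k. ?a (n + k)) - cf_value (\<lambda>k. ?b (n + k))\<bar> / (\<Prod>k<n. (real (?a k) + 1)\<^sup>2)) / (real (a 0) + 1)\<^sup>2"
    by (simp add: prod.lessThan_Suc_shift mult.commute del: prod.lessThan_Suc)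
  also have "\<dots> \<le> \<bar>cf_value ?a - cf_value ?b\<bar> / (real (a 0) + 1)\<^sup>2"
    using Suc.prems by (intro divide_right_mono Suc.IH) auto
  also have "\<dots> \<le> \<bar>cf_value a - cf_value b\<bar>"
    using Suc.prems by (intro cf_value_diff_same_head) auto
  finally show ?case .
qed simp

text \<open>A tail whose digits are at least 2 contributes at most 1/2, so different leading digits
  cannot be compensated by the tails.\<close>

lemma cf_value_diff_ge_of_digit_less:
  assumes "\<forall>n. a n \<ge> 2" "\<forall>n. b n \<ge> 2" "a 0 < b 0"
  shows "\<bar>cf_value a - cf_value b\<bar> \<ge> (real (b 0) - real (a 0)) / (8 * real (a 0) * real (b 0))"
proof -
  have a1: "\<forall>n. a n \<ge> 1" and b1: "\<forall>n. b n \<ge> 1" using assms(1,2) by (meson one_le_numeral order_trans)+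
  define s t where "s = cf_value (\<lambda>k. a (Suc k))" and "t = cf_value (\<lambda>k. b (Suc k))"
  define p q where "p = real (a 0)" and "q = real (b 0)"
  have st: "0 < s" "s < 1" "0 < t" "t < 1"
    using cf_value_in_unit_interval[of "\<lambda>k. a (Suc k)"] cf_value_in_unit_interval[of "\<lambda>k. b (Suc k)"] a1 b1
    by (auto simp: s_def t_def)
  have pq: "p \<ge> 2" "q \<ge> p + 1" using assms by (auto simp: p_def q_def)
  have "s = 1 / (real (a 1) + cf_value (\<lambda>k. a (Suc (Suc k))))"
    unfolding s_def using a1 by (subst cf_value_unfold) auto
  also have "\<dots> \<le> 1 / 2"
    using cf_value_in_unit_interval(1)[of "\<lambda>k. a (Suc (Suc k))"] a1 assms(1)
    by (intro divide_left_mono) (auto intro!: add_increasing2 mult_pos_pos add_pos_pos simp: Suc_le_eq)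
  finally have s: "s \<le> 1/2" .
  have "(q - p) / (8 * p * q) \<le> ((q - p) / 2) / ((2 * p) * (2 * q))" by simp
  also have "\<dots> \<le> (q - p + t - s) / ((2 * p) * (2 * q))" using s st pq by (intro divide_right_mono) auto
  also have "\<dots> \<le> (q - p + t - s) / ((p + s) * (q + t))"
    using s st pq by (intro divide_left_mono mult_mono mult_pos_pos) auto
  also have "\<dots> = 1 / (p + s) - 1 / (q + t)" using st pq by (simp add: divide_simps)
  also have "\<dots> \<le> \<bar>cf_value a - cf_value b\<bar>"
    unfolding cf_value_unfold[OF a1] cf_value_unfold[OF b1] by (simp add: s_def t_def p_def q_def)
  finally show ?thesis by (simp add: p_def q_def)
qed

section \<open>Measurability of partial quotients\<close>

lemma partial_quotients_0:
  assumes "x \<in> {0..1} - \<rat>"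
  shows "partial_quotients x 0 = nat \<lfloor>1 / x\<rfloor>"
  using is_cf_expansion_step(3)[OF is_cf_expansion_partial_quotients[OF assms] assms] by simp

lemma partial_quotients_Suc:
  assumes "x \<in> {0..1} - \<rat>"
  shows "frac (1 / x) \<in> {0..1} - \<rat>" "partial_quotients x (Suc n) = partial_quotients (frac (1 / x)) n"
proof -
  note step = is_cf_expansion_step[OF is_cf_expansion_partial_quotients[OF assms] assms]
  have "frac (1 / x) = 1 / x - real (partial_quotients x 0)"
    unfolding frac_def step(3)[symmetric] by simp
  thus 1: "frac (1 / x) \<in> {0..1} - \<rat>" and "partial_quotients x (Suc n) = partial_quotients (frac (1 / x)) n"
    using step(2) fun_cong[OF is_cf_expansion_unique[OF step(1) is_cf_expansion_partial_quotients[OF step(2)] step(2)], of n]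
    by metis+
qed

text \<open>The digits are given by a definite description, from which measurability cannot be read
  off. The Gauss map shifts the expansion, which turns each digit into an explicit Borel
  function.\<close>

lemma partial_quotients_eq_gauss_map:
  "x \<in> {0..1} - \<rat> \<Longrightarrow> partial_quotients x n = nat \<lfloor>1 / ((\<lambda>y. frac (1 / y)) ^^ n) x\<rfloor>"
proof (induction n arbitrary: x)
  case (Suc n)
  show ?case
    unfolding funpow_Suc_right comp_apply partial_quotients_Suc(2)[OF Suc.prems]
    by (rule Suc.IH) (rule partial_quotients_Suc(1)[OF Suc.prems])
qed (simp add: partial_quotients_0)

lemma borel_irrational_unit_interval: "{0..1} - \<rat> \<in> sets (borel :: real measure)"
proof (rule sets.Diff)
  show "(\<rat> :: real set) \<in> sets borel"
    by (rule sets.countable[OF _ countable_rat]) simp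
qed simp

lemma measurable_partial_quotients:
  assumes "A \<subseteq> {0..1} - \<rat>"
  shows "(\<lambda>x. partial_quotients x n) \<in> restrict_space borel A \<rightarrow>\<^sub>M count_space UNIV"
proof -
  have frac: "frac \<in> borel_measurable (borel :: real measure)"
    unfolding frac_def by measurable
  have "((\<lambda>y :: real. frac (1 / y)) ^^ n) \<in> borel_measurable borel"
  proof (induction n)
    case (Suc n)
    show ?case using measurable_compose[OF Suc.IH, of "\<lambda>y. frac (1 / y)" borel]
      measurable_compose[OF _ frac, of "\<lambda>y. 1 / y" borel] by (simp add: comp_def)
  qed (simp add: id_def)
  hence "(\<lambda>x. nat \<lfloor>1 / ((\<lambda>y :: real. frac (1 / y)) ^^ n) x\<rfloor>) \<in> borel \<rightarrow>\<^sub>M count_space UNIV"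
    by measurable
  hence "(\<lambda>x. nat \<lfloor>1 / ((\<lambda>y :: real. frac (1 / y)) ^^ n) x\<rfloor>) \<in> restrict_space borel A \<rightarrow>\<^sub>M count_space UNIV"
    by (rule measurable_restrict_space1)
  thus ?thesis
    by (rule measurable_cong[THEN iffD1, rotated])
       (use assms partial_quotients_eq_gauss_map in \<open>auto simp: space_restrict_space subset_iff\<close>)
qed

text \<open>\<open>emeasure_hausdorff_measure\<close> identifies the Hausdorff measure with the
  outer measure on Borel sets; this makes it applicable to the set in question.\<close>

lemma borel_cf_bounded_below_set: "cf_bounded_below_set \<alpha> \<in> sets borel"
proof -
  let ?I = "{0..1} - \<rat> :: real set"
  note [measurable] = measurable_partial_quotients[OF order_refl]
  have "{x \<in> space (restrict_space borel ?I). \<forall>n. partial_quotients x n \<ge> partial_quotients \<alpha> n}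
      \<in> sets (restrict_space borel ?I)"
    by measurable
  also have "{x \<in> space (restrict_space borel ?I). \<forall>n. partial_quotients x n \<ge> partial_quotients \<alpha> n}
      = cf_bounded_below_set \<alpha>"
    by (auto simp: cf_bounded_below_set_def space_restrict_space)
  finally show ?thesis
    using borel_irrational_unit_interval by (simp add: sets_restrict_space_iff)
qed

section \<open>The upper bound for the Hausdorff dimension\<close>

text \<open>For L \<le> 1 the images of a \<delta>-cover form a \<delta>-cover again, so the
  estimate stays at one scale and can be iterated without refining \<delta>.\<close>

lemma hausdorff_premeasure_Lipschitz_image:
  fixes f :: "real \<Rightarrow> real"
  assumes s: "s > 0" and L: "0 < L" "L \<le> 1" and \<delta>: "\<delta> \<ge> 0"
    and lip: "\<And>x y. x \<in> A \<Longrightarrow> y \<in> A \<Longrightarrow> \<bar>f x - f y\<bar> \<le> L * \<bar>x - y\<bar>"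
  shows "hausdorff_premeasure s \<delta> (f ` A) \<le> ennreal (L powr s) * hausdorff_premeasure s \<delta> A"
proof -
  \<comment> \<open>The factor is moved to the other side by multiplying with its inverse, so that
    the bound can be proved cover by cover under the infimum.\<close>
  have inv: "ennreal (L powr s) * (ennreal (L powr - s) * z) = z"
    "ennreal (L powr - s) * (ennreal (L powr s) * z) = z" for z
    using L by (simp_all add: mult.assoc[symmetric] powr_add[symmetric] flip: ennreal_mult)
  have "ennreal (L powr - s) * hausdorff_premeasure s \<delta> (f ` A) \<le> hausdorff_premeasure s \<delta> A"
    unfolding hausdorff_premeasure_def[of s \<delta> A]
  proof (rule INF_greatest)
    fix U assume U: "U \<in> hausdorff_covers \<delta> A"
    hence bU: "bounded (U i)" "diameter (U i) \<le> \<delta>" for i by (auto simp: hausdorff_covers_def)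
    define V where "V i = f ` (U i \<inter> A)" for i
    have dist: "\<bar>f x - f y\<bar> \<le> L * diameter (U i)" if "x \<in> U i \<inter> A" "y \<in> U i \<inter> A" for x y i
    proof -
      have "\<bar>x - y\<bar> \<le> diameter (U i)"
        using diameter_bounded_bound[OF bU(1), of x i y] that by (simp add: dist_real_def)
      thus ?thesis using lip[of x y] that L by (meson IntD2 mult_left_mono order_trans less_imp_le)
    qed
    have bV: "bounded (V i)" for i
      unfolding bounded_def V_def dist_real_def using dist[of _ i] by (cases "U i \<inter> A = {}") blast+
    have dV: "diameter (V i) \<le> L * diameter (U i)" for i
      using dist[of _ i] diameter_ge_0[OF bU(1)[of i]] L
      by (intro diameter_le) (auto simp: V_def)
    have "V \<in> hausdorff_covers \<delta> (f ` A)"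
      unfolding hausdorff_covers_def
    proof (intro CollectI conjI allI bV)
      show "f ` A \<subseteq> (\<Union>i. V i)" using U by (fastforce simp: V_def hausdorff_covers_def)
      show "diameter (V i) \<le> \<delta>" for i
        using dV[of i] bU(2)[of i] mult_right_mono[OF L(2) diameter_ge_0[OF bU(1)[of i]]] by simp
    qed
    hence "hausdorff_premeasure s \<delta> (f ` A) \<le> (\<Sum>i. hausdorff_gauge s (V i))"
      unfolding hausdorff_premeasure_def by (rule INF_lower)
    also have "\<dots> \<le> (\<Sum>i. ennreal (L powr s) * hausdorff_gauge s (U i))"
    proof (intro suminf_le allI)
      fix i
      show "hausdorff_gauge s (V i) \<le> ennreal (L powr s) * hausdorff_gauge s (U i)"
      proof (cases "V i = {}")
        case False
        hence "U i \<noteq> {}" by (auto simp: V_def)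
        have "diameter (V i) powr s \<le> (L * diameter (U i)) powr s"
          using s dV[of i] diameter_ge_0[OF bV[of i]] by (intro powr_mono2) auto
        also have "\<dots> = L powr s * diameter (U i) powr s"
          using L diameter_ge_0[OF bU(1)[of i]] by (simp add: powr_mult)
        finally show ?thesis using False \<open>U i \<noteq> {}\<close> s
          by (simp add: hausdorff_gauge_def flip: ennreal_mult)
      qed simp
    qed auto
    also have "\<dots> = ennreal (L powr s) * (\<Sum>i. hausdorff_gauge s (U i))" by simp
    finally show "ennreal (L powr - s) * hausdorff_premeasure s \<delta> (f ` A) \<le> (\<Sum>i. hausdorff_gauge s (U i))"
      using inv(2) mult_left_mono by (metis zero_le)
  qed
  thus ?thesis using inv(1) mult_left_mono by (metis zero_le)
qed

text \<open>A cover with small total gauge automatically consists of sets of small diameter.\<close>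

lemma hausdorff_outer_eq_0I:
  assumes s: "s > 0" and null: "hausdorff_premeasure s \<delta> A = 0"
  shows "hausdorff_outer s A = 0"
proof -
  have "hausdorff_premeasure s \<eta> A \<le> 0" if "\<eta> > 0" for \<eta>
  proof (rule ennreal_le_epsilon)
    fix e :: real assume e: "e > 0"
    define e' where "e' = min e (\<eta> powr s)"
    have "0 < e'" using e that by (simp add: e'_def)
    hence "hausdorff_premeasure s \<delta> A < ennreal e'" by (simp add: null)
    then obtain U where U: "U \<in> hausdorff_covers \<delta> A" "(\<Sum>i. hausdorff_gauge s (U i)) < ennreal e'"
      unfolding hausdorff_premeasure_def INF_less_iff by blast
    have "diameter (U i) \<le> \<eta>" for i
    proof (cases "U i = {}")
      case False
      have bU: "bounded (U i)" using U by (auto simp: hausdorff_covers_def)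
      have "hausdorff_gauge s (U i) \<le> (\<Sum>i. hausdorff_gauge s (U i))"
        using sum_le_suminf[of "\<lambda>i. hausdorff_gauge s (U i)" "{i}"] by auto
      hence "ennreal (diameter (U i) powr s) < ennreal e'"
        using U(2) False s by (simp add: hausdorff_gauge_def)
      hence "diameter (U i) powr s \<le> \<eta> powr s" by (auto simp: e'_def ennreal_less_iff)
      thus ?thesis using s that diameter_ge_0[OF bU] by (meson linorder_not_less powr_less_mono2 less_imp_le)
    qed (use that in \<open>simp add: diameter_empty\<close>)
    hence "U \<in> hausdorff_covers \<eta> A" using U(1) by (auto simp: hausdorff_covers_def)
    hence "hausdorff_premeasure s \<eta> A \<le> (\<Sum>i. hausdorff_gauge s (U i))"
      unfolding hausdorff_premeasure_def by (rule INF_lower)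
    also have "\<dots> \<le> ennreal e'" using U(2) by (rule less_imp_le)
    also have "\<dots> \<le> ennreal e" by (intro ennreal_leI) (simp add: e'_def)
    finally show "hausdorff_premeasure s \<eta> A \<le> 0 + ennreal e" by simp
  qed
  thus ?thesis unfolding hausdorff_outer_def by (intro antisym SUP_least) auto
qed

text \<open>The sequence of lower bounds is the parameter, so that the tails of the elements form a
  set of the same kind, for the shifted sequence.\<close>

definition cf_set :: "(nat \<Rightarrow> nat) \<Rightarrow> real set" where
  "cf_set a = cf_value ` {b. \<forall>n. a n \<le> b n}"

lemma cf_set_subset:
  assumes "\<forall>n. a n \<ge> 1"
  shows "cf_set a \<subseteq> {0..1}"
proof
  fix x assume "x \<in> cf_set a"
  then obtain b where b: "x = cf_value b" "\<forall>n. b n \<ge> a n" by (auto simp: cf_set_def)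
  have "\<forall>n. b n \<ge> 1" using assms b(2) by (meson order_trans)
  thus "x \<in> {0..1}" using cf_value_bounds b(1) by simp
qed

text \<open>The branch of digit m contracts by m^-2; this is the sum of the s-th powers of these
  ratios over the admissible digits.\<close>

definition tail_weight :: "real \<Rightarrow> nat \<Rightarrow> ennreal" where
  "tail_weight s N = (\<Sum>m. if N \<le> m then ennreal (real m powr (- (2 * s))) else 0)"

text \<open>Sort the points by their leading digit m. Their tails belong to the set for the shifted
  bounds, where the branch y -> 1/(m + y) is Lipschitz with constant m^-2, and subadditivity adds up
  the contributions.\<close>

lemma cf_set_step:
  assumes a: "\<forall>n. a n \<ge> 1" and s: "s > 0"
  shows "hausdorff_premeasure s 1 (cf_set a)
    \<le> tail_weight s (a 0) * hausdorff_premeasure s 1 (cf_set (\<lambda>k. a (Suc k)))"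
proof -
  let ?Y = "cf_set (\<lambda>k. a (Suc k))"
  \<comment> \<open>Digits below \<open>a 0\<close> get the empty set, so that the union runs over
    all natural numbers, as countable subadditivity requires.\<close>
  define X where "X m = (if a 0 \<le> m then (\<lambda>y. 1 / (real m + y)) ` ?Y else {})" for m
  have "cf_set a \<subseteq> (\<Union>m. X m)"
  proof
    fix x assume "x \<in> cf_set a"
    then obtain b where b: "x = cf_value b" "\<forall>n. b n \<ge> a n" by (auto simp: cf_set_def)
    have "\<forall>n. b n \<ge> 1" using a b(2) by (meson order_trans)
    hence "x = 1 / (real (b 0) + cf_value (\<lambda>k. b (Suc k)))"
      unfolding b(1) by (rule cf_value_unfold)
    moreover have "cf_value (\<lambda>k. b (Suc k)) \<in> ?Y" unfolding cf_set_def using b(2) by (intro imageI) simp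
    ultimately have "x \<in> (\<lambda>y. 1 / (real (b 0) + y)) ` ?Y" by (rule image_eqI)
    moreover have "a 0 \<le> b 0" using b(2) by simp
    ultimately have "x \<in> X (b 0)" by (simp only: X_def if_True)
    thus "x \<in> (\<Union>m. X m)" by blast
  qed
  hence "hausdorff_premeasure s 1 (cf_set a) \<le> hausdorff_premeasure s 1 (\<Union>m. X m)"
    by (rule hausdorff_premeasure_mono)
  also have "\<dots> \<le> (\<Sum>m. hausdorff_premeasure s 1 (X m))"
    by (rule hausdorff_premeasure_UN_le)
  also have "\<dots> \<le> (\<Sum>m. (if a 0 \<le> m then ennreal (real m powr (- (2 * s))) else 0) * hausdorff_premeasure s 1 ?Y)"
  proof (intro suminf_le allI)
    fix m
    show "hausdorff_premeasure s 1 (X m)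
      \<le> (if a 0 \<le> m then ennreal (real m powr (- (2 * s))) else 0) * hausdorff_premeasure s 1 ?Y"
    proof (cases "a 0 \<le> m")
      case True
      have m: "real m \<ge> 1" using order_trans[OF spec[OF a, of 0] True] by simp
      define L where "L = real m powr - 2"
      have L: "L = 1 / (real m * real m)"
        using m by (simp add: L_def powr_minus power2_eq_square inverse_eq_divide)
      moreover have "1 * 1 \<le> real m * real m" using m by (intro mult_mono) auto
      ultimately have L01: "0 < L" "L \<le> 1" using m by simp_all
      have Y: "y \<ge> 0" if "y \<in> ?Y" for y
        using cf_set_subset[of "\<lambda>k. a (Suc k)"] a that by auto
      have "hausdorff_premeasure s 1 (X m) = hausdorff_premeasure s 1 ((\<lambda>y. 1 / (real m + y)) ` ?Y)"
        using True by (simp add: X_def)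
      also have "\<dots> \<le> ennreal (L powr s) * hausdorff_premeasure s 1 ?Y"
      proof (rule hausdorff_premeasure_Lipschitz_image)
        fix x y assume "x \<in> ?Y" "y \<in> ?Y"
        hence xy: "x \<ge> 0" "y \<ge> 0" using Y by auto
        have "\<bar>1 / (real m + x) - 1 / (real m + y)\<bar> = \<bar>x - y\<bar> / ((real m + x) * (real m + y))"
          using m xy by (intro inverse_shift_diff) auto
        also have "\<dots> \<le> \<bar>x - y\<bar> / (real m * real m)"
          using m xy by (intro divide_left_mono mult_mono mult_pos_pos) auto
        finally show "\<bar>1 / (real m + x) - 1 / (real m + y)\<bar> \<le> L * \<bar>x - y\<bar>" by (simp add: L)
      qed (use s L01 in auto)
      also have "L powr s = real m powr (- (2 * s))" by (simp add: L_def powr_powr)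
      finally show ?thesis using True by simp
    next
      case False
      have "hausdorff_premeasure s 1 (X m) \<le> hausdorff_outer s (X m)"
        by (rule hausdorff_premeasure_le_outer) simp
      thus ?thesis using False by (simp add: X_def)
    qed
  qed auto
  also have "\<dots> = tail_weight s (a 0) * hausdorff_premeasure s 1 ?Y" by (simp add: tail_weight_def)
  finally show ?thesis .
qed

lemma tail_weight_le_half:
  assumes "s > 1/2"
  shows "eventually (\<lambda>N. tail_weight s N \<le> ennreal (1/2)) sequentially"
proof -
  let ?f = "\<lambda>m. real m powr (- (2 * s))"
  have sm: "summable ?f" using assms by (simp add: summable_real_powr_iff)
  then obtain N where N: "\<And>n. n \<ge> N \<Longrightarrow> norm (\<Sum>i. ?f (i + n)) < 1/2"
    using suminf_exist_split[of "1/2" ?f] by auto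
  have "tail_weight s n \<le> ennreal (1/2)" if "n \<ge> N" for n
  proof -
    have "tail_weight s n = (\<Sum>i. ennreal (?f (i + n)))"
      unfolding tail_weight_def
      by (subst suminf_offset[where i = n]) (auto simp: summableI intro!: sum.neutral)
    also have "\<dots> = ennreal (\<Sum>i. ?f (i + n))"
      by (intro suminf_ennreal2 summable_ignore_initial_segment sm) auto
    also have "\<dots> \<le> ennreal (1/2)" using N[OF that] by (intro ennreal_leI) auto
    finally show ?thesis .
  qed
  thus ?thesis by (auto simp: eventually_sequentially)
qed

lemma premeasure_cf_set_le_1:
  assumes "\<forall>n. a n \<ge> 1" "s > 0"
  shows "hausdorff_premeasure s 1 (cf_set a) \<le> 1"
proof -
  define U where "U i = (if i = 0 then {0..1::real} else {})" for i :: nat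
  have "U \<in> hausdorff_covers 1 (cf_set a)"
    using cf_set_subset[OF assms(1)]
    by (auto simp: hausdorff_covers_def U_def diameter_closed_interval intro!: exI[of _ 0])
  hence "hausdorff_premeasure s 1 (cf_set a) \<le> (\<Sum>i. hausdorff_gauge s (U i))"
    unfolding hausdorff_premeasure_def by (rule INF_lower)
  also have "\<dots> = (\<Sum>i\<in>{0}. hausdorff_gauge s (U i))"
    by (rule suminf_finite) (auto simp: U_def)
  also have "\<dots> = 1" using assms(2) by (simp add: U_def hausdorff_gauge_def diameter_closed_interval)
  finally show ?thesis .
qed

text \<open>While the tail weights are at most 1/2, every digit split off halves the premeasure at
  scale 1, which is at most 1 to begin with. As \<open>a\<close> tends to infinity, some shift of it
  has such weights throughout, and the premeasure of its set vanishes.\<close>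

lemma hausdorff_outer_cf_set_eq_0:
  assumes a: "\<forall>n. a n \<ge> 1" "filterlim a at_top sequentially" and s: "s > 1/2"
  shows "hausdorff_outer s (cf_set a) = 0"
proof -
  have s0: "s > 0" using s by simp
  have pow: "hausdorff_premeasure s 1 (cf_set b) \<le> ennreal ((1/2) ^ n)"
    if "\<forall>k. b k \<ge> 1" "\<forall>k. tail_weight s (b k) \<le> ennreal (1/2)" for b n
    using that
  proof (induction n arbitrary: b)
    case 0
    thus ?case using premeasure_cf_set_le_1[OF _ s0] by simp
  next
    case (Suc n)
    have "hausdorff_premeasure s 1 (cf_set b)
        \<le> tail_weight s (b 0) * hausdorff_premeasure s 1 (cf_set (\<lambda>k. b (Suc k)))"
      by (rule cf_set_step[OF Suc.prems(1) s0])
    also have "\<dots> \<le> ennreal (1/2) * ennreal ((1/2) ^ n)"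
      using Suc.prems by (intro mult_mono Suc.IH) auto
    also have "\<dots> = ennreal ((1/2) * (1/2) ^ n)" by (rule ennreal_mult[symmetric]) auto
    also have "\<dots> = ennreal ((1/2) ^ Suc n)" by simp
    finally show ?case .
  qed
  obtain N where N: "\<And>k. k \<ge> N \<Longrightarrow> tail_weight s (a k) \<le> ennreal (1/2)"
    using eventually_compose_filterlim[OF tail_weight_le_half[OF s] a(2)] by (auto simp: eventually_sequentially)
  have "hausdorff_premeasure s 1 (cf_set (\<lambda>k. a (N + k))) \<le> 0"
  proof (rule LIMSEQ_le_const)
    have "(\<lambda>n. ennreal ((1/2) ^ n)) \<longlonglongrightarrow> ennreal 0"
      by (intro tendsto_ennrealI LIMSEQ_power_zero) auto
    thus "(\<lambda>n. ennreal ((1/2) ^ n)) \<longlonglongrightarrow> 0" by (simp only: ennreal_0)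
    have "hausdorff_premeasure s 1 (cf_set (\<lambda>k. a (N + k))) \<le> ennreal ((1/2) ^ n)" for n
    proof (rule pow)
      show "\<forall>k. 1 \<le> a (N + k)" using a(1) by blast
      show "\<forall>k. tail_weight s (a (N + k)) \<le> ennreal (1/2)" using N le_add1 by blast
    qed
    thus "\<exists>M. \<forall>n\<ge>M. hausdorff_premeasure s 1 (cf_set (\<lambda>k. a (N + k))) \<le> ennreal ((1/2) ^ n)"
      by blast
  qed
  hence "hausdorff_premeasure s 1 (cf_set (\<lambda>k. a (N + k))) = 0" by simp
  \<comment> \<open>The first N bounds may have larger tail weights, but putting them back one at a
    time multiplies zero.\<close>
  hence "hausdorff_premeasure s 1 (cf_set a) = 0"
    using a(1)
  proof (induction N arbitrary: a)
    case (Suc N)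
    have "hausdorff_premeasure s 1 (cf_set (\<lambda>k. a (Suc k))) = 0"
      by (rule Suc.IH; simp add: Suc.prems[simplified])
    thus ?case using cf_set_step[OF Suc.prems(2) s0] by simp
  qed simp
  thus ?thesis by (rule hausdorff_outer_eq_0I[OF s0])
qed

section \<open>The mass distribution principle\<close>

lemma hausdorff_gauge_antimono:
  assumes "0 \<le> s" "s \<le> r" "r > 0" "bounded U" "diameter U \<le> 1"
  shows "hausdorff_gauge r U \<le> hausdorff_gauge s U"
  using assms diameter_ge_0[OF assms(4)]
  by (auto simp: hausdorff_gauge_def powr_le1 intro!: ennreal_leI powr_mono')

lemma hausdorff_outer_antimono:
  assumes "0 \<le> s" "s \<le> r" "r > 0"
  shows "hausdorff_outer r A \<le> hausdorff_outer s A"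
  unfolding hausdorff_outer_def[of r]
proof (rule SUP_least)
  fix \<delta> :: real assume "\<delta> \<in> {0<..}"
  \<comment> \<open>A larger exponent gives a smaller power only for diameters at most 1, hence the
    passage to scale \<open>min 1 \<delta>\<close>.\<close>
  have "hausdorff_premeasure r \<delta> A \<le> hausdorff_premeasure r (min 1 \<delta>) A"
    by (rule hausdorff_premeasure_antimono) simp
  also have "\<dots> \<le> hausdorff_premeasure s (min 1 \<delta>) A"
    unfolding hausdorff_premeasure_def
  proof (rule INF_mono)
    fix U assume U: "U \<in> hausdorff_covers (min 1 \<delta>) A"
    hence "(\<Sum>i. hausdorff_gauge r (U i)) \<le> (\<Sum>i. hausdorff_gauge s (U i))"
      using assms by (intro suminf_le allI hausdorff_gauge_antimono) (auto simp: hausdorff_covers_def)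
    thus "\<exists>V\<in>hausdorff_covers (min 1 \<delta>) A. (\<Sum>i. hausdorff_gauge r (V i)) \<le> (\<Sum>i. hausdorff_gauge s (U i))"
      using U by blast
  qed
  also have "\<dots> \<le> hausdorff_outer s A"
    using \<open>\<delta> \<in> {0<..}\<close> by (intro hausdorff_premeasure_le_outer) auto
  finally show "hausdorff_premeasure r \<delta> A \<le> hausdorff_outer s A" .
qed

lemma hausdorff_dim_eqI:
  assumes "d > 0" "hausdorff_outer d A \<noteq> 0" "\<And>s. s > d \<Longrightarrow> hausdorff_outer s A = 0"
  shows "hausdorff_dim A = ereal d"
  unfolding hausdorff_dim_def
proof (rule antisym)
  show "Inf {ereal s |s. 0 \<le> s \<and> hausdorff_outer s A = 0} \<le> ereal d"
  proof (rule ereal_le_epsilon2)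
    fix e :: real assume "0 < e"
    thus "Inf {ereal s |s. 0 \<le> s \<and> hausdorff_outer s A = 0} \<le> ereal d + ereal e"
      using assms by (intro Inf_lower) auto
  qed
  show "ereal d \<le> Inf {ereal s |s. 0 \<le> s \<and> hausdorff_outer s A = 0}"
  proof (rule Inf_greatest, clarify)
    fix s assume s: "0 \<le> s" "hausdorff_outer s A = 0"
    show "ereal d \<le> ereal s"
      using hausdorff_outer_antimono[OF s(1), of d A] assms(1,2) s(2) by (cases "s \<le> d") auto
  qed
qed

text \<open>The bound is stated at a fixed scale \<delta> with an explicit constant c, because later
  \<delta> depends on c. Testing M on intervals suffices, as every nonempty covering set lies in an
  interval whose length is at most its diameter.\<close>

lemma emeasure_le_premeasure:
  fixes M :: "real measure"
  assumes "s > 0" "c > 0" "A \<in> sets M"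
    and meas: "\<And>u v. {u..v} \<inter> space M \<in> sets M"
    and frostman: "\<And>u v. u \<le> v \<Longrightarrow> v - u \<le> \<delta> \<Longrightarrow> emeasure M ({u..v} \<inter> space M) \<le> ennreal (c * (v - u) powr s)"
  shows "emeasure M A \<le> ennreal c * hausdorff_premeasure s \<delta> A"
proof -
  have inv: "ennreal c * (ennreal (1 / c) * z) = z" "ennreal (1 / c) * (ennreal c * z) = z" for z
    using assms(2) by (simp_all add: mult.assoc[symmetric] flip: ennreal_mult)
  have "ennreal (1 / c) * emeasure M A \<le> hausdorff_premeasure s \<delta> A"
    unfolding hausdorff_premeasure_def
  proof (rule INF_greatest)
    fix U assume U: "U \<in> hausdorff_covers \<delta> A"
    hence bU: "bounded (U i)" "diameter (U i) \<le> \<delta>" for i by (auto simp: hausdorff_covers_def)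
    \<comment> \<open>A covering set need not be measurable, so the interval it spans replaces it.
      The empty set is treated apart, since \<open>Inf\<close> and \<open>Sup\<close> carry no
      information there.\<close>
    define V where "V i = (if U i = {} then {} else {Inf (U i)..Sup (U i)} \<inter> space M)" for i
    have UV: "U i \<inter> space M \<subseteq> V i" for i
      using bounded_imp_bdd_above[OF bU(1)[of i]] bounded_imp_bdd_below[OF bU(1)[of i]]
      by (auto simp: V_def intro: cInf_lower cSup_upper)
    have V: "V i \<in> sets M" "emeasure M (V i) \<le> ennreal c * hausdorff_gauge s (U i)" for i
    proof -
      show "V i \<in> sets M" using meas by (auto simp: V_def)
      show "emeasure M (V i) \<le> ennreal c * hausdorff_gauge s (U i)"
      proof (cases "U i = {}")
        case False
        let ?u = "Inf (U i)" and ?v = "Sup (U i)"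
        note bdd = bounded_imp_bdd_above[OF bU(1)[of i]] bounded_imp_bdd_below[OF bU(1)[of i]]
        have uv: "?u \<le> ?v" using False bdd by (intro cInf_le_cSup)
        have "?v \<le> ?u + diameter (U i)"
        proof (rule cSup_least[OF False])
          fix y assume y: "y \<in> U i"
          have "y - diameter (U i) \<le> ?u"
          proof (rule cInf_greatest[OF False])
            fix x assume "x \<in> U i"
            thus "y - diameter (U i) \<le> x"
              using diameter_bounded_bound[OF bU(1)[of i], of y x] y by (simp add: dist_real_def)
          qed
          thus "y \<le> ?u + diameter (U i)" by simp
        qed
        hence d: "?v - ?u \<le> diameter (U i)" by simp
        have "emeasure M (V i) \<le> ennreal (c * (?v - ?u) powr s)"
          using frostman[OF uv] d bU(2)[of i] False by (simp add: V_def)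
        also have "\<dots> \<le> ennreal (c * diameter (U i) powr s)"
          using assms(1,2) uv d by (intro ennreal_leI mult_left_mono powr_mono2) auto
        also have "\<dots> = ennreal c * hausdorff_gauge s (U i)"
          using False assms(1,2) by (simp add: hausdorff_gauge_def ennreal_mult)
        finally show ?thesis .
      qed (simp add: V_def)
    qed
    have "A \<subseteq> (\<Union>i. V i)"
      using U UV sets.sets_into_space[OF assms(3)] by (fastforce simp: hausdorff_covers_def)
    hence "emeasure M A \<le> emeasure M (\<Union>i. V i)" using V(1) by (intro emeasure_mono) auto
    also have "\<dots> \<le> (\<Sum>i. emeasure M (V i))" using V(1) by (intro emeasure_subadditive_countably) auto
    also have "\<dots> \<le> (\<Sum>i. ennreal c * hausdorff_gauge s (U i))" by (intro suminf_le allI V(2)) auto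
    also have "\<dots> = ennreal c * (\<Sum>i. hausdorff_gauge s (U i))" by simp
    finally show "ennreal (1 / c) * emeasure M A \<le> (\<Sum>i. hausdorff_gauge s (U i))"
      using inv(2) mult_left_mono by (metis zero_le)
  qed
  thus ?thesis using inv(1) mult_left_mono by (metis zero_le)
qed

section \<open>Tracking a slowly varying target\<close>

text \<open>Once the target moves by less than 1/4 per step, S - t always moves in the direction of
  0, by less than 1 + 1/4. So it overshoots by at most 5/4, |S - t| stays bounded, and division by t
  makes the difference vanish in the limit.\<close>

lemma ratio_tendsto_1_of_tracking:
  fixes S t :: "nat \<Rightarrow> real"
  assumes down: "\<And>n. S n > t n \<Longrightarrow> S (Suc n) - S n \<in> {-1..-1/4}"
    and up: "\<And>n. S n \<le> t n \<Longrightarrow> S (Suc n) - S n \<in> {1/2..1}"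
    and t: "filterlim t at_top sequentially"
    and t_slow: "(\<lambda>n. t (Suc n) - t n) \<longlonglongrightarrow> 0"
  shows "(\<lambda>n. S n / t n) \<longlonglongrightarrow> 1"
proof -
  have "eventually (\<lambda>n. \<bar>t (Suc n) - t n\<bar> < 1/4) sequentially"
    using tendstoD[OF t_slow, of "1/4"] by (simp add: dist_real_def)
  then obtain N where N: "\<And>n. n \<ge> N \<Longrightarrow> \<bar>t (Suc n) - t n\<bar> < 1/4"
    by (auto simp: eventually_sequentially)
  define C where "C = max \<bar>S N - t N\<bar> (5/4)"
  have bound: "\<bar>S n - t n\<bar> \<le> C" if "n \<ge> N" for n
    using that
  proof (induction n rule: dec_induct)
    case (step n)
    have "C \<ge> 5/4" by (simp add: C_def)
    thus ?case
      using step.IH N[OF step.hyps(1)] down[of n] up[of n]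
      unfolding atLeastAtMost_iff by (cases "S n > t n"; linarith)
  qed (simp add: C_def)
  have lim: "(\<lambda>n. C / t n) \<longlonglongrightarrow> 0"
    by (intro real_tendsto_divide_at_top[OF tendsto_const] t)
  have t0: "eventually (\<lambda>n. t n > 0) sequentially"
    using t by (simp add: filterlim_at_top_dense)
  have "eventually (\<lambda>n. norm (S n / t n - 1) \<le> C / t n) sequentially"
    using t0 eventually_ge_at_top[of N]
  proof eventually_elim
    case (elim n)
    have "S n / t n - 1 = (S n - t n) / t n" using elim by (simp add: field_simps)
    hence "norm (S n / t n - 1) = \<bar>S n - t n\<bar> / t n" using elim(1) by (simp add: abs_divide)
    also have "\<dots> \<le> C / t n" using elim by (intro divide_right_mono bound) auto
    finally show ?case .
  qed
  hence "(\<lambda>n. S n / t n - 1) \<longlonglongrightarrow> 0" using lim by (rule Lim_null_comparison)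
  thus ?thesis by (simp add: LIM_zero_iff)
qed

lemma iterated_log_scale_at_top:
  "filterlim (\<lambda>n. sqrt (2 * real n * ln (ln (real n)))) at_top sequentially"
  by real_asymp

lemma iterated_log_scale_slow:
  "(\<lambda>n. sqrt (2 * real (Suc n) * ln (ln (real (Suc n)))) - sqrt (2 * real n * ln (ln (real n)))) \<longlonglongrightarrow> 0"
  by real_asymp

section \<open>Growth of the weights\<close>

text \<open>The finitely many indices that violate the inequality cost a constant independent of
  n.\<close>

lemma sum_le_of_eventually_le:
  fixes f h :: "nat \<Rightarrow> real"
  assumes "eventually (\<lambda>k. f k \<le> h k) sequentially"
  obtains C where "\<And>n. (\<Sum>k<n. f k) \<le> C + (\<Sum>k<n. h k)"
proof -
  obtain N where N: "\<And>k. k \<ge> N \<Longrightarrow> f k \<le> h k" using assms by (auto simp: eventually_sequentially)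
  have "(\<Sum>k<n. f k) \<le> (\<Sum>k<N. max 0 (f k - h k)) + (\<Sum>k<n. h k)" for n
  proof -
    have "(\<Sum>k<n. f k - h k) \<le> (\<Sum>k<n. max 0 (f k - h k))" by (intro sum_mono) auto
    also have "\<dots> = (\<Sum>k\<in>{..<n} \<inter> {..<N}. max 0 (f k - h k))"
    proof (intro sum.mono_neutral_right ballI)
      fix i assume "i \<in> {..<n} - {..<n} \<inter> {..<N}"
      thus "max 0 (f i - h i) = 0" using N[of i] by auto
    qed auto
    also have "\<dots> \<le> (\<Sum>k<N. max 0 (f k - h k))" by (intro sum_mono2) auto
    finally show ?thesis by (simp add: sum_subtractf)
  qed
  thus thesis using that by blast
qed

text \<open>A weak Stirling bound for ln((n - 1)!): the term at 0 vanishes because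
  \<open>ln 0 = 0\<close>, and the induction step reduces to n ln(1 + 1/n) \<le> 1.\<close>

lemma sum_ln_ge: "(\<Sum>k<n. ln (real k)) \<ge> (real n - 1) * ln (real n) - real n"
proof (induction n)
  case (Suc n)
  show ?case
  proof (cases "n = 0")
    case False
    have "real n * (ln (real (Suc n)) - ln (real n)) = real n * ln (1 + 1 / real n)"
      using False by (subst ln_divide_pos[symmetric]) (auto simp: field_simps)
    also have "\<dots> \<le> real n * (1 / real n)"
      by (intro mult_left_mono ln_add_one_self_le_self) auto
    also have "\<dots> \<le> 1" by simp
    finally show ?thesis using Suc.IH by (simp add: algebra_simps)
  qed simp
qed simp

lemma x_ln_x_ge:
  assumes "x \<ge> (1 :: real)"
  shows "x * ln x \<ge> x - 1"
proof -
  have "ln (1 / x) \<le> 1 / x - 1" using assms by (intro ln_le_minus_one) auto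
  moreover have "ln (1 / x) = - ln x" using assms by (simp add: ln_div)
  ultimately have "1 - 1 / x \<le> ln x" by linarith
  hence "x * (1 - 1 / x) \<le> x * ln x" using assms by (intro mult_left_mono) auto
  moreover have "x * (1 - 1 / x) = x - 1" using assms by (simp add: right_diff_distrib)
  ultimately show ?thesis by simp
qed

context
  fixes a g w :: "nat \<Rightarrow> real"
  assumes a: "\<And>n. a n \<ge> 1" and g: "\<And>n. g n \<ge> 1" "\<And>n. g n * ln (g n) = ln (a n)"
    and g_top: "filterlim g at_top sequentially"
    and w: "\<And>n. w n > 0" "eventually (\<lambda>n. w n \<le> 4 / g n) sequentially"
begin

lemma weights_null_of_ln:
  assumes "filterlim (\<lambda>n. 2 * (\<Sum>k<n. ln (w k)) + ln (a n) + 2 * g n) at_bot sequentially"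
  shows "(\<lambda>n. (\<Prod>k<n. w k)\<^sup>2 * (a n * exp (2 * g n))) \<longlonglongrightarrow> 0"
proof -
  have "(\<Prod>k<n. w k)\<^sup>2 * (a n * exp (2 * g n)) = exp (2 * (\<Sum>k<n. ln (w k)) + ln (a n) + 2 * g n)" for n
  proof -
    have "(\<Prod>k<n. w k) = exp (\<Sum>k<n. ln (w k))" using w(1) by (simp add: exp_sum)
    thus ?thesis using a[of n] by (simp add: exp_add exp_double)
  qed
  thus ?thesis using filterlim_compose[OF exp_at_bot assms] by simp
qed

text \<open>As g tends to infinity, the product of the weights decays faster than any geometric
  sequence, while g \<le> 1 + ln a bounds \<open>a n * exp (2 * g n)\<close> by a constant times
  l^(3n).\<close>

lemma weights_null_exponential:
  assumes "\<And>n. n \<ge> 1 \<Longrightarrow> a n \<le> C * l ^ n" "l > 1"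
  shows "(\<lambda>n. (\<Prod>k<n. w k)\<^sup>2 * (a n * exp (2 * g n))) \<longlonglongrightarrow> 0"
proof (rule weights_null_of_ln)
  have "0 < C * l" using assms(1)[of 1] a[of 1] by simp
  hence C: "C > 0" using assms(2) by (simp add: zero_less_mult_iff)
  \<comment> \<open>With ln w eventually at most -B/2, twice the sum is at most a constant minus B
    n. The part 3 ln l cancels the growth of ln a + 2 g, and the 1 leaves -n.\<close>
  define B where "B = 3 * ln l + 1"
  have "B > 0" using assms(2) by (simp add: B_def add_pos_pos)
  have "eventually (\<lambda>k. 4 * exp (B / 2) \<le> g k) sequentially"
    using g_top by (simp add: filterlim_at_top)
  hence "eventually (\<lambda>k. ln (w k) \<le> - B / 2) sequentially"
    using w(2)
  proof eventually_elim
    case (elim k)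
    have "w k \<le> 4 / (4 * exp (B / 2))"
      using elim(2) by (rule order_trans) (use elim(1) in \<open>intro divide_left_mono; simp add: less_le_trans[OF _ elim(1)]\<close>)
    also have "\<dots> = exp (- B / 2)" by (simp add: exp_minus field_simps)
    finally have "ln (w k) \<le> ln (exp (- B / 2))" using w(1)[of k] by (intro ln_mono) auto
    thus ?case by simp
  qed
  then obtain D where D: "\<And>n. (\<Sum>k<n. ln (w k)) \<le> D + (\<Sum>k<n. - B / 2)"
    by (rule sum_le_of_eventually_le) auto
  have "eventually (\<lambda>n. 2 * (\<Sum>k<n. ln (w k)) + ln (a n) + 2 * g n \<le> (2 * D + 3 * ln C + 2) - real n) sequentially"
    using eventually_ge_at_top[of 1]
  proof eventually_elim
    case (elim n)
    have "ln (a n) \<le> ln (C * l ^ n)"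
      using assms(1)[OF elim] a[of n] by (intro ln_mono) auto
    also have "\<dots> = ln C + n * ln l" using C assms(2) by (simp add: ln_mult ln_realpow)
    finally have "ln (a n) \<le> ln C + n * ln l" .
    moreover have "g n \<le> 1 + ln (a n)" using x_ln_x_ge[OF g(1)[of n]] g(2)[of n] by simp
    moreover have "2 * (\<Sum>k<n. ln (w k)) \<le> 2 * D - B * n" using D[of n] by (simp add: algebra_simps)
    ultimately show ?case by (simp add: B_def algebra_simps)
  qed
  moreover have "filterlim (\<lambda>n. (2 * D + 3 * ln C + 2) - real n) at_bot sequentially"
    by real_asymp
  ultimately show "filterlim (\<lambda>n. 2 * (\<Sum>k<n. ln (w k)) + ln (a n) + 2 * g n) at_bot sequentially"
    by (rule filterlim_at_bot_mono[rotated])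
qed

text \<open>By g^2 \<ge> g ln g = ln a and the lower bound on a, g is at least of order sqrt k, so
  the squared product of the weights is at most 1/(n - 1)! up to an exponential factor. Up to a
  constant, 2 g \<le> \<epsilon> ln a, so the other factor has logarithm at most (1 + \<epsilon>)(1
  - \<epsilon>) n ln n plus a constant. What survives is -\<epsilon>^2 n ln n.\<close>

lemma weights_null_superexponential:
  assumes low: "\<And>n. n \<ge> 1 \<Longrightarrow> l ^ n \<le> C * a n" and "l > 1"
    and up: "\<And>n. n \<ge> 1 \<Longrightarrow> a n \<le> C' * real n powr (real n * (1 - \<epsilon>))" and "\<epsilon> > 0"
  shows "(\<lambda>n. (\<Prod>k<n. w k)\<^sup>2 * (a n * exp (2 * g n))) \<longlonglongrightarrow> 0"
proof (rule weights_null_of_ln)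
  have "0 < C * a 1" using low[of 1] assms(2) by simp
  hence C: "C > 0" using a[of 1] by (simp add: zero_less_mult_iff)
  have C': "C' > 0" using up[of 1] a[of 1] by simp
  define c where "c = ln l"
  have c: "c > 0" using assms(2) by (simp add: c_def)
  define D where "D = 2 * ln 4 - ln (c / 2)"
  have "eventually (\<lambda>k. real k * c - ln C \<ge> real k * (c / 2)) sequentially"
    using c by real_asymp
  hence "eventually (\<lambda>k. ln (w k) \<le> (D - ln (real k)) / 2) sequentially"
    using w(2) eventually_ge_at_top[of 1]
  proof eventually_elim
    case (elim k)
    have k: "real k > 0" using elim(3) by simp
    have "real k * c = ln (l ^ k)" using assms(2) by (simp add: c_def ln_realpow)
    also have "\<dots> \<le> ln (C * a k)"
      using low[OF elim(3)] assms(2) C by (intro ln_mono) auto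
    also have "\<dots> = ln C + g k * ln (g k)" using C a[of k] g(2)[of k] by (simp add: ln_mult)
    also have "g k * ln (g k) \<le> g k * g k"
      using g(1)[of k] ln_le_minus_one[of "g k"] by (intro mult_left_mono) auto
    finally have "real k * (c / 2) \<le> g k * g k" using elim(1) by linarith
    hence "ln (real k * (c / 2)) \<le> ln (g k * g k)" using k c by (intro ln_mono) auto
    moreover have "ln (real k * (c / 2)) = ln (real k) + ln (c / 2)" using k c by (intro ln_mult_pos) auto
    moreover have "ln (g k * g k) = 2 * ln (g k)" using g(1)[of k] by (simp add: ln_mult)
    moreover have "ln (w k) \<le> ln (4 / g k)" using w(1)[of k] elim(2) g(1)[of k] by (intro ln_mono) auto
    moreover have "ln (4 / g k) = ln 4 - ln (g k)" using g(1)[of k] by (intro ln_divide_pos) auto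
    ultimately show ?case by (simp add: D_def)
  qed
  then obtain E where E: "\<And>n. (\<Sum>k<n. ln (w k)) \<le> E + (\<Sum>k<n. (D - ln (real k)) / 2)"
    by (rule sum_le_of_eventually_le) auto
  define F where "F = 2 * E + (1 + \<epsilon>) * ln C' + 2 * exp (2 / \<epsilon>)"
  have "eventually (\<lambda>n. 2 * (\<Sum>k<n. ln (w k)) + ln (a n) + 2 * g n
      \<le> F + (D + 1) * real n + ln (real n) - \<epsilon>\<^sup>2 * (real n * ln (real n))) sequentially"
    using eventually_ge_at_top[of 1]
  proof eventually_elim
    case (elim n)
    have n: "real n > 0" using elim by simp
    \<comment> \<open>Past exp(2/\<epsilon>), ln g is at least 2/\<epsilon>, so that \<epsilon> g ln
      g = \<epsilon> ln a absorbs 2 g; below this threshold 2 g is bounded.\<close>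
    have gn: "2 * g n \<le> 2 * exp (2 / \<epsilon>) + \<epsilon> * ln (a n)"
    proof (cases "g n \<le> exp (2 / \<epsilon>)")
      case True
      have "\<epsilon> * ln (a n) \<ge> 0" using a[of n] assms(4) by simp
      with True show ?thesis by linarith
    next
      case False
      hence "2 / \<epsilon> \<le> ln (g n)" using g(1)[of n] by (simp add: ln_ge_iff)
      hence "g n * (2 / \<epsilon>) \<le> ln (a n)" unfolding g(2)[symmetric] using g(1)[of n] by (intro mult_left_mono) auto
      hence "2 * g n \<le> \<epsilon> * ln (a n)" using assms(4) by (simp add: field_simps)
      thus ?thesis using exp_ge_zero[of "2/\<epsilon>"] by linarith
    qed
    have "ln (a n) \<le> ln (C' * real n powr (real n * (1 - \<epsilon>)))"
      using up[OF elim] a[of n] by (intro ln_mono) auto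
    also have "\<dots> = ln C' + real n * (1 - \<epsilon>) * ln (real n)"
      using C' n by (simp add: ln_mult ln_powr)
    finally have "(1 + \<epsilon>) * ln (a n) \<le> (1 + \<epsilon>) * (ln C' + real n * (1 - \<epsilon>) * ln (real n))"
      using assms(4) by (intro mult_left_mono) auto
    moreover have "2 * (\<Sum>k<n. ln (w k)) \<le> 2 * E + D * real n - (\<Sum>k<n. ln (real k))"
      using E[of n] by (simp add: sum_subtractf sum_divide_distrib[symmetric] field_simps)
    moreover note sum_ln_ge[of n] gn
    ultimately show ?case by (simp add: F_def algebra_simps power2_eq_square)
  qed
  moreover have "filterlim (\<lambda>n. F + (D + 1) * real n + ln (real n) - \<epsilon>\<^sup>2 * (real n * ln (real n))) at_bot sequentially"
    using assms(4) by real_asymp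
  ultimately show "filterlim (\<lambda>n. 2 * (\<Sum>k<n. ln (w k)) + ln (a n) + 2 * g n) at_bot sequentially"
    by (rule filterlim_at_bot_mono[rotated])
qed

end

section \<open>A random continued fraction\<close>

text \<open>Comparison with the integral of 1/x in telescoped form. Rounding A up causes the + 1 in
  the denominator; rounding B down costs nothing, since the telescoped sum ends at the last integer
  plus 1.\<close>

lemma sum_inverse_ge_ln:
  fixes A B :: real
  assumes "A > 0" "A \<le> B"
  shows "finite {m :: nat. A \<le> real m \<and> real m \<le> B}"
    "ln (B / (A + 1)) \<le> (\<Sum>m | A \<le> real m \<and> real m \<le> B. 1 / real m)"
proof -
  define p q where "p = nat \<lceil>A\<rceil>" and "q = nat \<lfloor>B\<rfloor>"
  have eq: "{m :: nat. A \<le> real m \<and> real m \<le> B} = {p..q}"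
    unfolding p_def q_def using assms by (auto simp: le_nat_floor nat_ceiling_le_eq) linarith
  show "finite {m :: nat. A \<le> real m \<and> real m \<le> B}" by (simp add: eq)
  show "ln (B / (A + 1)) \<le> (\<Sum>m | A \<le> real m \<and> real m \<le> B. 1 / real m)"
  proof (cases "B \<le> A + 1")
    case True
    hence "ln (B / (A + 1)) \<le> 0" using assms by simp
    also have "0 \<le> (\<Sum>m | A \<le> real m \<and> real m \<le> B. 1 / real m)" by (intro sum_nonneg) auto
    finally show ?thesis .
  next
    case False
    have p: "real p > 0" "real p \<le> A + 1" unfolding p_def using assms by linarith+
    have q: "B \<le> real (Suc q)" unfolding q_def using assms by linarith
    have "real p < real (Suc q)" using p(2) q False by linarith
    hence "p \<le> Suc q" by linarith
    have "ln (B / (A + 1)) \<le> ln (real (Suc q) / real p)"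
      using p q assms by (intro ln_mono frac_le) auto
    also have "\<dots> = ln (real (Suc q)) - ln (real p)" using p by (intro ln_divide_pos) auto
    also have "\<dots> = (\<Sum>m=p..q. ln (real (Suc m)) - ln (real m))"
      using sum_Suc_diff[OF \<open>p \<le> Suc q\<close>, of "\<lambda>m. ln (real m)"] by simp
    also have "\<dots> \<le> (\<Sum>m=p..q. 1 / real m)"
    proof (rule sum_mono)
      fix m assume "m \<in> {p..q}"
      hence m: "real m > 0" using p by auto
      have "ln (real (Suc m)) - ln (real m) = ln (1 + 1 / real m)"
        using m by (subst ln_divide_pos[symmetric]) (auto simp: field_simps)
      thus "ln (real (Suc m)) - ln (real m) \<le> 1 / real m"
        using ln_add_one_self_le_self[of "1 / real m"] by simp
    qed
    finally show ?thesis by (simp add: eq)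
  qed
qed

lemma measurable_cf_convergent:
  assumes "\<And>k. (\<lambda>\<omega>. x \<omega> k) \<in> M \<rightarrow>\<^sub>M count_space UNIV"
  shows "(\<lambda>\<omega>. cf_convergent (x \<omega>) n) \<in> borel_measurable M"
  using assms
proof (induction n arbitrary: x)
  case (Suc n)
  note [measurable] = Suc.prems[of 0] Suc.IH[of "\<lambda>\<omega> k. x \<omega> (Suc k)", OF Suc.prems]
  show ?case by simp
qed simp

locale digit_data =
  fixes a :: "nat \<Rightarrow> nat" and g :: "nat \<Rightarrow> real"
  assumes a_ge_1: "a n \<ge> 1" and g_ge_1: "g n \<ge> 1" and g_ln: "g n * ln (g n) = ln (real (a n))"
    and summable_a: "summable (\<lambda>n. 1 / real (a n))"
begin

text \<open>For n \<le> 2 the values rest on the conventions that \<open>ln 0 = 0\<close> and that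
  the root of a negative number is negative; only the behaviour for large n matters.\<close>

definition target :: "nat \<Rightarrow> real" where
  "target n = sqrt (2 * real n * ln (ln (real n)))"

text \<open>The digits at which the normalised increment \<open>ln (m / a k) / g k - 1\<close> lies in \<open>[1/2, 1]\<close>
  (for \<open>up\<close>) or in \<open>[-1, -1/4]\<close>. Starting the latter at \<open>a k + 1\<close> keeps all digits above 1.\<close>

definition digits :: "nat \<Rightarrow> bool \<Rightarrow> nat set" where
  "digits k up = {m. (if up then real (a k) * exp (3/2 * g k) else real (a k) + 1) \<le> real m
     \<and> real m \<le> real (a k) * exp ((if up then 2 else 3/4) * g k)}"

definition weight :: "nat \<Rightarrow> bool \<Rightarrow> real" where
  "weight k up = (\<Sum>m\<in>digits k up. 1 / real m)"

text \<open>The larger of the two normalising factors, so that \<open>w k / m\<close> bounds the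
  probability of the digit m whichever interval it is drawn from.\<close>

definition w :: "nat \<Rightarrow> real" where
  "w k = 1 / min (weight k True) (weight k False)"

definition digit_max :: "nat \<Rightarrow> real" where
  "digit_max k = real (a k) * exp (2 * g k)"

definition choice_measure :: "nat \<times> bool \<Rightarrow> nat measure" where
  "choice_measure i = point_measure (digits (fst i) (snd i))
     (\<lambda>m. ennreal (1 / real m / weight (fst i) (snd i)))"

text \<open>Both candidate digits of every step are drawn in advance, independently, and only one of
  them is read. This makes the history-dependent digit process a function on an ordinary product
  space.\<close>

definition P :: "(nat \<times> bool \<Rightarrow> nat) measure" where
  "P = PiM UNIV choice_measure"

primrec state :: "(nat \<times> bool \<Rightarrow> nat) \<Rightarrow> nat \<Rightarrow> real" where
  "state \<omega> 0 = 0"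
| "state \<omega> (Suc k) = state \<omega> k + (ln (real (\<omega> (k, state \<omega> k \<le> target k)) / real (a k)) / g k - 1)"

definition digit :: "(nat \<times> bool \<Rightarrow> nat) \<Rightarrow> nat \<Rightarrow> nat" where
  "digit \<omega> k = \<omega> (k, state \<omega> k \<le> target k)"

section \<open>Digit intervals and their harmonic sums\<close>

lemma a_real_ge_1: "real (a k) \<ge> 1"
  using a_ge_1[of k] by simp

lemma exp_three_quarters_ge: "2 \<le> exp (3/4 :: real)"
proof -
  \<comment> \<open>At x = 3/4 the inequality 1 + x \<le> exp x is too weak; at x = 3/32 the eighth
    power works, since (35/32)^8 > 2.\<close>
  have "1 + 3/32 \<le> exp (3/32 :: real)" by (rule exp_ge_add_one_self)
  hence "(1 + 3/32) ^ 8 \<le> exp (3/32 :: real) ^ 8" by (intro power_mono) auto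
  also have "exp (3/32 :: real) ^ 8 = exp (3/4)" by (simp flip: exp_of_nat_mult)
  finally show ?thesis by (simp add: power_divide)
qed

text \<open>Hence both digit intervals contain an integer: the lower one starts at the integer
  \<open>a k + 1\<close>, and the upper one has length at least 1.\<close>

lemma digits_range:
  "real (a k) + 1 \<le> real (a k) * exp (3/4 * g k)"
  "real (a k) * exp (3/2 * g k) + 1 \<le> real (a k) * exp (2 * g k)"
proof -
  have "real (a k) + 1 \<le> real (a k) * 2" using a_real_ge_1[of k] by simp
  also have "\<dots> \<le> real (a k) * exp (3/4 * g k)"
    using g_ge_1[of k] by (intro mult_left_mono order_trans[OF exp_three_quarters_ge]) auto
  finally show "real (a k) + 1 \<le> real (a k) * exp (3/4 * g k)" .
  have "1 + 1/2 * g k \<le> exp (1/2 * g k)" "1 + 3/2 * g k \<le> exp (3/2 * g k)"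
    by (rule exp_ge_add_one_self)+
  hence "1/2 \<le> exp (1/2 * g k) - 1" "2 \<le> exp (3/2 * g k)" using g_ge_1[of k] by linarith+
  hence "2 * (1/2) \<le> exp (3/2 * g k) * (exp (1/2 * g k) - 1)" by (intro mult_mono) auto
  also have "\<dots> = exp (2 * g k) - exp (3/2 * g k)" by (simp add: algebra_simps flip: exp_add)
  finally have "1 * 1 \<le> real (a k) * (exp (2 * g k) - exp (3/2 * g k))"
    using a_real_ge_1[of k] by (intro mult_mono) auto
  thus "real (a k) * exp (3/2 * g k) + 1 \<le> real (a k) * exp (2 * g k)"
    by (simp add: algebra_simps)
qed

lemma finite_digits: "finite (digits k up)"
proof -
  have "digits k up \<subseteq> {..nat \<lfloor>real (a k) * exp ((if up then 2 else 3/4) * g k)\<rfloor>}"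
    by (auto simp: digits_def le_nat_floor)
  thus ?thesis by (rule finite_subset) simp
qed

lemma digits_nonempty: "digits k up \<noteq> {}"
proof (cases up)
  case True
  have "nat \<lceil>real (a k) * exp (3/2 * g k)\<rceil> \<in> digits k up"
    using digits_range(2)[of k] True by (simp add: digits_def) linarith
  thus ?thesis by blast
next
  case False
  hence "a k + 1 \<in> digits k up" using digits_range(1)[of k] by (simp add: digits_def)
  thus ?thesis by blast
qed

lemma digits_bounds:
  assumes "m \<in> digits k up"
  shows "real m \<ge> real (a k) + 1" "real m \<le> digit_max k" "m \<ge> 2" "m \<ge> a k"
    "ln (real m / real (a k)) / g k - 1 \<in> (if up then {1/2..1} else {-1..-1/4})"
proof -
  have "exp (3/4 * g k) \<le> exp (3/2 * g k)" "exp (3/2 * g k) \<le> exp (2 * g k)" using g_ge_1[of k] by auto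
  hence *: "real (a k) * exp (3/4 * g k) \<le> real (a k) * exp (3/2 * g k)"
    "real (a k) * exp (3/2 * g k) \<le> real (a k) * exp (2 * g k)"
    by (intro mult_left_mono; simp)+
  show 1: "real m \<ge> real (a k) + 1"
    using assms *(1) digits_range(1)[of k] by (auto simp: digits_def split: if_splits)
  show "real m \<le> digit_max k"
    using assms * by (auto simp: digits_def digit_max_def split: if_splits)
  show "m \<ge> a k" "m \<ge> 2" using 1 a_ge_1[of k] by linarith+
  define lo hi where "lo = (if up then 3/2 * g k else 0)" and "hi = (if up then 2 else 3/4) * g k"
  have a0: "real (a k) > 0" using a_ge_1[of k] by simp
  have "real (a k) * exp lo \<le> real m" "real m \<le> real (a k) * exp hi"
    using assms 1 by (auto simp: digits_def lo_def hi_def split: if_splits)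
  hence "exp lo \<le> real m / real (a k)" "real m / real (a k) \<le> exp hi"
    using a0 by (simp_all add: field_simps)
  moreover have "real m / real (a k) > 0" using 1 a0 by simp
  ultimately have "lo \<le> ln (real m / real (a k))" "ln (real m / real (a k)) \<le> hi"
    by (metis ln_ge_iff, metis ln_exp ln_mono)
  hence "lo / g k \<le> ln (real m / real (a k)) / g k" "ln (real m / real (a k)) / g k \<le> hi / g k"
    using g_ge_1[of k] by (simp_all add: divide_right_mono)
  moreover have "lo / g k = (if up then 3/2 else 0)" "hi / g k = (if up then 2 else 3/4)"
    using g_ge_1[of k] by (auto simp: lo_def hi_def)
  ultimately show "ln (real m / real (a k)) / g k - 1 \<in> (if up then {1/2..1} else {-1..-1/4})"
    by (cases up; simp only: if_True if_False atLeastAtMost_iff; linarith)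
qed

lemma weight_pos: "weight k up > 0"
  unfolding weight_def using digits_bounds(3) finite_digits digits_nonempty
  by (intro sum_pos) (auto simp: zero_less_divide_iff dest!: digits_bounds(3))

text \<open>The harmonic sums are at least g/2 - ln 2 (upper interval) and 3g/4 - ln 3 (lower
  interval). Both are at least g/4 from g = 3 on, because ln 2 \<le> 3/4 and ln 3 \<le> 3/2.\<close>

lemma weight_ge:
  assumes "g k \<ge> 3"
  shows "g k / 4 \<le> weight k up"
proof (cases up)
  case True
  let ?A = "real (a k) * exp (3/2 * g k)" and ?B = "real (a k) * exp (2 * g k)"
  have A: "?A \<ge> 1"
    using a_real_ge_1[of k] g_ge_1[of k] mult_mono[of 1 "real (a k)" 1 "exp (3/2 * g k)"] by simp
  have "g k / 2 - ln 2 = ln (?B / (2 * ?A))"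
    using a_real_ge_1[of k] by (simp add: ln_div ln_mult)
  also have "\<dots> \<le> ln (?B / (?A + 1))"
  proof (intro ln_mono divide_left_mono)
    have "0 < real (a k)" using a_real_ge_1[of k] by linarith
    thus "0 < ?B / (2 * ?A)" "0 \<le> ?B" "0 < 2 * ?A * (?A + 1)" by (simp_all add: add_pos_pos)
    show "?A + 1 \<le> 2 * ?A" using A by linarith
  qed
  also have "\<dots> \<le> weight k up"
    unfolding weight_def digits_def using True A digits_range(2)[of k]
    using sum_inverse_ge_ln(2)[of ?A ?B] by simp
  finally have "g k / 2 - ln 2 \<le> weight k up" .
  moreover have "ln 2 \<le> (3/4 :: real)" using ln_mono[OF exp_three_quarters_ge] by simp
  ultimately show ?thesis using assms by linarith
next
  case False
  let ?A = "real (a k) + 1" and ?B = "real (a k) * exp (3/4 * g k)"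
  have "3/4 * g k - ln 3 = ln (?B / (3 * real (a k)))"
    using a_real_ge_1[of k] by (simp add: ln_div ln_mult)
  also have "\<dots> \<le> ln (?B / (?A + 1))"
  proof (intro ln_mono divide_left_mono)
    have "0 < real (a k)" using a_real_ge_1[of k] by linarith
    thus "0 < ?B / (3 * real (a k))" "0 \<le> ?B" "0 < 3 * real (a k) * (?A + 1)" by (simp_all add: add_pos_pos)
    show "?A + 1 \<le> 3 * real (a k)" using a_real_ge_1[of k] by linarith
  qed
  also have "\<dots> \<le> weight k up"
    unfolding weight_def digits_def using False digits_range(1)[of k]
    using sum_inverse_ge_ln(2)[of ?A ?B] by simp
  finally have "3/4 * g k - ln 3 \<le> weight k up" .
  moreover have "ln 3 \<le> (3/2 :: real)"
  proof -
    have "2 * 2 \<le> exp (3/4) * exp (3/4 :: real)" by (intro mult_mono exp_three_quarters_ge) auto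
    hence "3 \<le> exp (3/2 :: real)" by (simp flip: exp_add)
    from ln_mono[OF this] show ?thesis by simp
  qed
  ultimately show ?thesis using assms by linarith
qed

lemma w_pos: "w k > 0"
  unfolding w_def using weight_pos by simp

lemma inverse_weight_le_w: "1 / weight k up \<le> w k"
  unfolding w_def using weight_pos[of k] by (cases up) (auto intro!: divide_left_mono)

lemma w_le: "g k \<ge> 3 \<Longrightarrow> w k \<le> 4 / g k"
proof -
  assume g: "g k \<ge> 3"
  have "w k \<le> 1 / (g k / 4)"
    unfolding w_def using weight_ge[OF g] g weight_pos[of k] by (intro divide_left_mono mult_pos_pos) auto
  thus ?thesis by simp
qed

section \<open>The product space and the adaptively chosen digits\<close>

lemma prob_space_choice_measure: "prob_space (choice_measure i)"
  unfolding choice_measure_def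
proof (rule prob_space_point_measure)
  let ?D = "digits (fst i) (snd i)" and ?W = "weight (fst i) (snd i)"
  have "(\<Sum>m\<in>?D. ennreal (1 / real m / ?W)) = ennreal (\<Sum>m\<in>?D. 1 / real m / ?W)"
    using weight_pos[of "fst i" "snd i"] by (intro sum_ennreal) auto
  also have "(\<Sum>m\<in>?D. 1 / real m / ?W) = ?W / ?W"
    unfolding sum_divide_distrib[symmetric] weight_def ..
  also have "\<dots> = 1" using weight_pos[of "fst i" "snd i"] by simp
  finally show "(\<Sum>m\<in>?D. ennreal (1 / real m / ?W)) = 1" by simp
qed (use finite_digits in auto)

sublocale product_prob_space choice_measure UNIV
  by (intro product_prob_spaceI prob_space_choice_measure)

lemma prob_space_P: "prob_space P"
  unfolding P_def by (rule P.prob_space_axioms)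

lemma measure_choice_measure_le:
  assumes "B \<subseteq> digits k up"
  shows "measure (choice_measure (k, up)) B \<le> w k * (\<Sum>m\<in>B. 1 / real m)"
proof -
  have "measure (choice_measure (k, up)) B = (\<Sum>m\<in>B. 1 / real m / weight k up)"
    unfolding choice_measure_def
    using assms finite_digits weight_pos[of k up]
    by (subst measure_point_measure_finite_if) (auto intro: less_imp_le)
  also have "\<dots> = (1 / weight k up) * (\<Sum>m\<in>B. 1 / real m)"
    by (simp add: sum_divide_distrib)
  also have "\<dots> \<le> w k * (\<Sum>m\<in>B. 1 / real m)"
    by (intro mult_right_mono inverse_weight_le_w sum_nonneg) auto
  finally show ?thesis .
qed

lemma coordinate_mem_digits: "\<omega> \<in> space P \<Longrightarrow> \<omega> (k, up) \<in> digits k up"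
  by (auto simp: P_def space_PiM choice_measure_def space_point_measure PiE_def Pi_def)

lemma digit_mem: "\<omega> \<in> space P \<Longrightarrow> digit \<omega> k \<in> digits k (state \<omega> k \<le> target k)"
  by (simp add: digit_def coordinate_mem_digits)

lemma state_eq_sum: "state \<omega> n = (\<Sum>k<n. ln (real (digit \<omega> k) / real (a k)) / g k - 1)"
  by (induction n) (simp_all add: digit_def)

lemma state_cong:
  "(\<And>k. k < n \<Longrightarrow> digit \<omega> k = digit \<omega>' k) \<Longrightarrow> state \<omega> n = state \<omega>' n"
  unfolding state_eq_sum by (intro sum.cong) auto

lemma digit_ratio_tendsto_1:
  assumes "\<omega> \<in> space P"
  shows "(\<lambda>n. (\<Sum>k<n. ln (real (digit \<omega> k) / real (a k)) / g k - 1) / target n) \<longlonglongrightarrow> 1"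
  unfolding state_eq_sum[symmetric]
proof (rule ratio_tendsto_1_of_tracking)
  have diff: "state \<omega> (Suc n) - state \<omega> n = ln (real (digit \<omega> n) / real (a n)) / g n - 1" for n
    by (simp add: digit_def)
  show "state \<omega> (Suc n) - state \<omega> n \<in> {-1..-1/4}" if "target n < state \<omega> n" for n
    unfolding diff using digits_bounds(5)[OF digit_mem[OF assms, of n]] that by (simp only: not_le[symmetric] if_False)
  show "state \<omega> (Suc n) - state \<omega> n \<in> {1/2..1}" if "state \<omega> n \<le> target n" for n
    unfolding diff using digits_bounds(5)[OF digit_mem[OF assms, of n]] that by (simp only: if_True)
qed (unfold target_def, rule iterated_log_scale_at_top, rule iterated_log_scale_slow)

lemma measurable_coordinate: "(\<lambda>\<omega>. \<omega> i) \<in> P \<rightarrow>\<^sub>M count_space UNIV"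
proof -
  have "(\<lambda>\<omega>. \<omega> i) \<in> P \<rightarrow>\<^sub>M choice_measure i" unfolding P_def by (rule measurable_component_singleton) simp
  moreover have "(\<lambda>x. x) \<in> choice_measure i \<rightarrow>\<^sub>M count_space UNIV"
    unfolding choice_measure_def by simp
  ultimately show ?thesis by (rule measurable_compose)
qed

lemma measurable_state: "(\<lambda>\<omega>. state \<omega> k) \<in> borel_measurable P"
proof (induction k)
  case (Suc k)
  note [measurable] = Suc.IH measurable_coordinate
  \<comment> \<open>The coordinate that is read is itself random, but only two are possible, so
    evaluation there is a measurable case distinction.\<close>
  have "(\<lambda>\<omega>. \<omega> (k, state \<omega> k \<le> target k)) = (\<lambda>\<omega>. if state \<omega> k \<le> target k then \<omega> (k, True) else \<omega> (k, False))"
    by auto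
  hence [measurable]: "(\<lambda>\<omega>. \<omega> (k, state \<omega> k \<le> target k)) \<in> P \<rightarrow>\<^sub>M count_space UNIV" by simp
  show ?case by simp
qed simp

lemma measurable_digit: "(\<lambda>\<omega>. digit \<omega> k) \<in> P \<rightarrow>\<^sub>M count_space UNIV"
proof -
  note [measurable] = measurable_state measurable_coordinate
  have "(\<lambda>\<omega>. digit \<omega> k) = (\<lambda>\<omega>. if state \<omega> k \<le> target k then \<omega> (k, True) else \<omega> (k, False))"
    by (auto simp: digit_def)
  thus ?thesis by simp
qed

lemma digit_ge:
  assumes "\<omega> \<in> space P"
  shows "\<forall>n. digit \<omega> n \<ge> 2" "\<forall>n. digit \<omega> n \<ge> 1" "\<forall>n. digit \<omega> n \<ge> a n"
proof -
  show 2: "\<forall>n. digit \<omega> n \<ge> 2" and "\<forall>n. digit \<omega> n \<ge> a n"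
    using digits_bounds(3,4)[OF digit_mem[OF assms]] by blast+
  show "\<forall>n. digit \<omega> n \<ge> 1" using 2 by (meson one_le_numeral order_trans)
qed

section \<open>The random point and the probability of cylinders\<close>

definition rcf :: "(nat \<times> bool \<Rightarrow> nat) \<Rightarrow> real" where
  "rcf \<omega> = cf_value (digit \<omega>)"

lemma measurable_rcf: "rcf \<in> borel_measurable P"
  by (rule borel_measurable_LIMSEQ_real[of P "\<lambda>n \<omega>. cf_convergent (digit \<omega>) n"])
     (auto simp: rcf_def intro!: cf_convergent_tendsto measurable_cf_convergent measurable_digit dest: digit_ge(2))

lemma rcf_mem: "\<omega> \<in> space P \<Longrightarrow> rcf \<omega> \<in> cf_set a"
  unfolding rcf_def cf_set_def using digit_ge(3) by blast

text \<open>On the event that the first \<open>n\<close> digits are prescribed the adaptive choices are prescribed as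
  well, so the event is contained in a cylinder of the product space.\<close>

lemma measure_cylinder_le:
  assumes \<omega>: "\<omega> \<in> space P" and E: "E \<subseteq> space P"
    and "\<And>\<omega>' k. \<omega>' \<in> E \<Longrightarrow> k < n \<Longrightarrow> digit \<omega>' k = digit \<omega> k" and B: "\<And>\<omega>'. \<omega>' \<in> E \<Longrightarrow> digit \<omega>' n \<in> B"
  shows "measure P E \<le> (\<Prod>k<n. w k / real (digit \<omega> k))
    * measure (choice_measure (n, state \<omega> n \<le> target n)) (B \<inter> digits n (state \<omega> n \<le> target n))"
proof -
  define c where "c k = (state \<omega> k \<le> target k)" for k
  \<comment> \<open>\<open>J\<close> collects the coordinates read by \<omega> up to time n. Every
    point of E reads the same ones, since the states up to time n depend on the digits before n
    only. \<open>X\<close> fixes the digits before n and confines the last one to B.\<close>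
  define X where "X i = (if fst i < n then {digit \<omega> (fst i)} else B \<inter> digits n (c n))" for i :: "nat \<times> bool"
  define J where "J = (\<lambda>k. (k, c k)) ` {..n}"
  have state: "state \<omega>' k = state \<omega> k" if "\<omega>' \<in> E" "k \<le> n" for \<omega>' k
    using that assms(3) by (intro state_cong) auto
  have dig: "digit \<omega>' k = \<omega>' (k, c k)" if "\<omega>' \<in> E" "k \<le> n" for \<omega>' k
    using state[OF that] by (simp add: digit_def c_def)
  have X: "X i \<in> sets (choice_measure i)" if "i \<in> J" for i
    using that digit_mem[OF \<omega>] by (auto simp: J_def X_def choice_measure_def sets_point_measure c_def)
  have "E \<subseteq> prod_emb UNIV choice_measure J (Pi\<^sub>E J X)"
  proof
    fix \<omega>' assume "\<omega>' \<in> E"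
    have "\<omega>' i \<in> X i" if "i \<in> J" for i
    proof -
      from that obtain k where k: "i = (k, c k)" "k \<le> n" by (auto simp: J_def)
      have "\<omega>' (k, c k) \<in> digits k (c k)" using E \<open>\<omega>' \<in> E\<close> coordinate_mem_digits by blast
      thus ?thesis
        using k assms(3)[OF \<open>\<omega>' \<in> E\<close>, of k] B[OF \<open>\<omega>' \<in> E\<close>] dig[OF \<open>\<omega>' \<in> E\<close> k(2)]
        by (auto simp: X_def)
    qed
    thus "\<omega>' \<in> prod_emb UNIV choice_measure J (Pi\<^sub>E J X)"
      using E \<open>\<omega>' \<in> E\<close> by (auto simp: prod_emb_def P_def space_PiM)
  qed
  hence "measure P E \<le> measure P (prod_emb UNIV choice_measure J (Pi\<^sub>E J X))"
    unfolding P_def using X by (intro finite_measure_mono sets_PiM_I) (auto simp: J_def)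
  also have "\<dots> = (\<Prod>i\<in>J. measure (choice_measure i) (X i))"
    unfolding P_def using X by (intro measure_PiM_emb) (auto simp: J_def)
  also have "\<dots> = (\<Prod>k\<le>n. measure (choice_measure (k, c k)) (X (k, c k)))"
    unfolding J_def by (subst prod.reindex) (auto simp: inj_on_def)
  also have "\<dots> = (\<Prod>k<n. measure (choice_measure (k, c k)) (X (k, c k)))
      * measure (choice_measure (n, c n)) (B \<inter> digits n (c n))"
    by (simp add: lessThan_Suc_atMost[symmetric] X_def)
  also have "\<dots> \<le> (\<Prod>k<n. w k / real (digit \<omega> k)) * measure (choice_measure (n, c n)) (B \<inter> digits n (c n))"
  proof (intro mult_right_mono prod_mono conjI measure_nonneg)
    fix k assume "k \<in> {..<n}"
    thus "measure (choice_measure (k, c k)) (X (k, c k)) \<le> w k / real (digit \<omega> k)"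
      using measure_choice_measure_le[of "{digit \<omega> k}" k "c k"] digit_mem[OF \<omega>, of k] by (simp add: X_def c_def)
  qed
  finally show ?thesis by (simp add: c_def)
qed

section \<open>Probabilities of intervals\<close>

definition prod_bound :: real where
  "prod_bound = exp (2 * (\<Sum>n. 1 / real (a n)))"

text \<open>Distances involve the digits increased by 1, probabilities the digits themselves.
  Passing from one to the other costs at most 1 + 1/a k \<le> exp(1/a k) per digit, which is bounded
  in total by summability.\<close>

lemma prod_Suc_digit_le:
  assumes "\<omega> \<in> space P"
  shows "(\<Prod>k<n. (real (digit \<omega> k) + 1)\<^sup>2) \<le> prod_bound * (\<Prod>k<n. real (digit \<omega> k))\<^sup>2"
proof -
  have "(\<Prod>k<n. (real (digit \<omega> k) + 1)\<^sup>2) \<le> (\<Prod>k<n. (real (digit \<omega> k) * exp (1 / real (a k)))\<^sup>2)"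
  proof (intro prod_mono conjI power_mono)
    fix k
    have d: "real (a k) \<le> real (digit \<omega> k)" using digit_ge(3)[OF assms] by simp
    have "real (digit \<omega> k) + 1 \<le> real (digit \<omega> k) * (1 + 1 / real (a k))"
      using d a_real_ge_1[of k] by (simp add: field_simps)
    also have "\<dots> \<le> real (digit \<omega> k) * exp (1 / real (a k))"
      by (intro mult_left_mono exp_ge_add_one_self) auto
    finally show "real (digit \<omega> k) + 1 \<le> real (digit \<omega> k) * exp (1 / real (a k))" .
  qed auto
  also have "\<dots> = (exp (\<Sum>k<n. 1 / real (a k)))\<^sup>2 * (\<Prod>k<n. real (digit \<omega> k))\<^sup>2"
    by (simp add: prod_power_distrib[symmetric] prod.distrib exp_sum power_mult_distrib mult.commute)
  also have "\<dots> \<le> prod_bound * (\<Prod>k<n. real (digit \<omega> k))\<^sup>2"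
  proof (rule mult_right_mono)
    have "(\<Sum>k<n. 1 / real (a k)) \<le> (\<Sum>n. 1 / real (a n))"
      using summable_a by (intro sum_le_suminf) auto
    thus "(exp (\<Sum>k<n. 1 / real (a k)))\<^sup>2 \<le> prod_bound"
      by (simp add: prod_bound_def flip: exp_double)
  qed auto
  finally show ?thesis .
qed

lemma digit_max_ge_1: "digit_max k \<ge> 1"
  unfolding digit_max_def using a_real_ge_1[of k] g_ge_1[of k] mult_mono[of 1 "real (a k)" 1 "exp (2 * g k)"] by simp

text \<open>Such a set lies in one cylinder of each depth n, of probability at most the product of
  the first n weights, and \<open>digit_max n\<close> is at least 1. This covers intervals in which
  no digit varies.\<close>

lemma measure_constant_digits_eq_0:
  assumes null: "(\<lambda>n. (\<Prod>k<n. w k)\<^sup>2 * digit_max n) \<longlonglongrightarrow> 0"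
    and E: "E \<subseteq> space P" "\<And>\<omega> \<omega>' k. \<omega> \<in> E \<Longrightarrow> \<omega>' \<in> E \<Longrightarrow> digit \<omega> k = digit \<omega>' k"
  shows "measure P E = 0"
proof (cases "E = {}")
  case False
  then obtain \<omega> where \<omega>: "\<omega> \<in> E" by blast
  have "(measure P E)\<^sup>2 \<le> (\<Prod>k<n. w k)\<^sup>2 * digit_max n" for n
  proof -
    have "measure P E \<le> (\<Prod>k<n. w k / real (digit \<omega> k))
      * measure (choice_measure (n, state \<omega> n \<le> target n)) (UNIV \<inter> digits n (state \<omega> n \<le> target n))"
      by (rule measure_cylinder_le[OF _ E(1) E(2)[OF _ \<omega>]]) (use \<omega> E(1) in auto)
    also have "\<dots> \<le> (\<Prod>k<n. w k) * 1"
    proof (rule mult_mono)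
      show "(\<Prod>k<n. w k / real (digit \<omega> k)) \<le> (\<Prod>k<n. w k)"
      proof (intro prod_mono conjI)
        fix k
        have "1 \<le> real (digit \<omega> k)" using digit_ge(2)[of \<omega>] \<omega> E(1) by auto
        hence "w k / real (digit \<omega> k) \<le> w k / 1"
          using less_imp_le[OF w_pos[of k]] by (intro divide_left_mono) auto
        thus "w k / real (digit \<omega> k) \<le> w k" by simp
        show "0 \<le> w k / real (digit \<omega> k)" using less_imp_le[OF w_pos[of k]] by simp
      qed
      show "0 \<le> (\<Prod>k<n. w k)" using less_imp_le[OF w_pos] by (intro prod_nonneg) auto
    qed (use prob_space.prob_le_1[OF prob_space_choice_measure] in auto)
    finally have "(measure P E)\<^sup>2 \<le> (\<Prod>k<n. w k)\<^sup>2 * 1" by (simp add: power_mono)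
    also have "\<dots> \<le> (\<Prod>k<n. w k)\<^sup>2 * digit_max n" by (intro mult_left_mono digit_max_ge_1) auto
    finally show ?thesis .
  qed
  hence "(measure P E)\<^sup>2 \<le> 0" by (intro LIMSEQ_le_const[OF null]) auto
  thus ?thesis by simp
qed simp

lemma dist_rcf_ge:
  assumes "\<omega> \<in> space P" "\<omega>' \<in> space P" "\<forall>k<n. digit \<omega> k = digit \<omega>' k" "digit \<omega> n < digit \<omega>' n"
  shows "(real (digit \<omega>' n) - real (digit \<omega> n)) / (8 * real (digit \<omega> n) * real (digit \<omega>' n))
      / (\<Prod>k<n. (real (digit \<omega> k) + 1)\<^sup>2) \<le> \<bar>rcf \<omega> - rcf \<omega>'\<bar>"
proof -
  have "(real (digit \<omega>' n) - real (digit \<omega> n)) / (8 * real (digit \<omega> n) * real (digit \<omega>' n))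
    \<le> \<bar>cf_value (\<lambda>k. digit \<omega> (n + k)) - cf_value (\<lambda>k. digit \<omega>' (n + k))\<bar>"
    using cf_value_diff_ge_of_digit_less[of "\<lambda>k. digit \<omega> (n + k)" "\<lambda>k. digit \<omega>' (n + k)"]
      digit_ge(1)[OF assms(1)] digit_ge(1)[OF assms(2)] assms(4) by simp
  hence "(real (digit \<omega>' n) - real (digit \<omega> n)) / (8 * real (digit \<omega> n) * real (digit \<omega>' n))
      / (\<Prod>k<n. (real (digit \<omega> k) + 1)\<^sup>2)
    \<le> \<bar>cf_value (\<lambda>k. digit \<omega> (n + k)) - cf_value (\<lambda>k. digit \<omega>' (n + k))\<bar> / (\<Prod>k<n. (real (digit \<omega> k) + 1)\<^sup>2)"
    by (intro divide_right_mono prod_nonneg) auto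
  also have "\<dots> \<le> \<bar>rcf \<omega> - rcf \<omega>'\<bar>"
    unfolding rcf_def using digit_ge(2)[OF assms(1)] digit_ge(2)[OF assms(2)] assms(3)
    by (intro cf_value_diff_same_prefix) auto
  finally show ?thesis .
qed

text \<open>Let n be the first index at which the digits vary within the interval, with extreme
  values m < m'. The interval has length at least (m' - m)/(8 m m' Q), where Q is comparable to the
  squared product q^2 of the common digits. Its probability is at most the product of the weights
  times p/q, where p is the probability of drawing a digit between m and m'. The quotient of squared
  probability and length is controlled by the null sequence at n.\<close>

lemma rcf_interval_bound:
  assumes null: "(\<lambda>n. (\<Prod>k<n. w k)\<^sup>2 * digit_max n) \<longlonglongrightarrow> 0"
    and w_le_1: "eventually (\<lambda>n. w n \<le> 1) sequentially" and e: "e > 0"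
  obtains \<delta> where "\<delta> > 0"
    "\<And>u v. u \<le> v \<Longrightarrow> v - u \<le> \<delta> \<Longrightarrow> measure P {\<omega> \<in> space P. rcf \<omega> \<in> {u..v}} \<le> e * sqrt (v - u)"
proof -
  let ?V = "\<lambda>n. (\<Prod>k<n. w k)\<^sup>2 * digit_max n"
  have "(\<lambda>n. 32 * prod_bound * ?V n) \<longlonglongrightarrow> 32 * prod_bound * 0"
    by (intro tendsto_intros null)
  hence "eventually (\<lambda>n. 32 * prod_bound * ?V n < e\<^sup>2) sequentially"
    by (rule order_tendstoD(2)) (use e in simp)
  with w_le_1 have "eventually (\<lambda>n. w n \<le> 1 \<and> 32 * prod_bound * ?V n < e\<^sup>2) sequentially"
    by eventually_elim auto
  then obtain N where N: "\<And>n. n \<ge> N \<Longrightarrow> w n \<le> 1 \<and> 32 * prod_bound * ?V n < e\<^sup>2"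
    by (auto simp: eventually_sequentially)
  define R where "R n = (\<Prod>k<n. (digit_max k + 1)\<^sup>2)" for n
  have fac: "(digit_max k + 1)\<^sup>2 \<ge> 1" for k
    using digit_max_ge_1[of k] by (simp add: one_le_power)
  have R_pos: "R n > 0" for n unfolding R_def using less_le_trans[OF zero_less_one fac] by (intro prod_pos) auto
  have R_mono: "R m \<le> R n" if "m \<le> n" for m n
    unfolding R_def using that fac by (intro prod_mono2) (auto intro: order_trans[OF zero_le_one])
  \<comment> \<open>If digits differed before index N, the length would be at least 1/(8 R N), which
    exceeds this \<delta>. So short intervals have their first varying digit at N or later, where
    the null sequence is small.\<close>
  define \<delta> where "\<delta> = 1 / (16 * R N)"
  have "measure P {\<omega> \<in> space P. rcf \<omega> \<in> {u..v}} \<le> e * sqrt (v - u)" if uv: "u \<le> v" "v - u \<le> \<delta>" for u v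
  proof -
    define E where "E = {\<omega> \<in> space P. rcf \<omega> \<in> {u..v}}"
    have EP: "E \<subseteq> space P" by (auto simp: E_def)
    show ?thesis
    proof (cases "\<exists>n. \<exists>\<omega>\<in>E. \<exists>\<omega>'\<in>E. digit \<omega> n \<noteq> digit \<omega>' n")
      case False
      have "digit \<omega> k = digit \<omega>' k" if "\<omega> \<in> E" "\<omega>' \<in> E" for \<omega> \<omega>' k
        using False that by blast
      hence "measure P E = 0" by (rule measure_constant_digits_eq_0[OF null EP])
      thus ?thesis using e uv by (simp add: E_def)
    next
      case True
      define n where "n = (LEAST n. \<exists>\<omega>\<in>E. \<exists>\<omega>'\<in>E. digit \<omega> n \<noteq> digit \<omega>' n)"
      have n: "\<exists>\<omega>\<in>E. \<exists>\<omega>'\<in>E. digit \<omega> n \<noteq> digit \<omega>' n" using LeastI_ex[OF True] by (simp add: n_def)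
      have same: "digit \<omega> k = digit \<omega>' k" if "\<omega> \<in> E" "\<omega>' \<in> E" "k < n" for \<omega> \<omega>' k
        using not_less_Least[OF that(3)[unfolded n_def]] that(1,2) by blast
      define D where "D = (\<lambda>\<omega>. digit \<omega> n) ` E"
      have dmax: "real (digit \<omega> k) \<le> digit_max k" if "\<omega> \<in> E" for \<omega> k
        using digits_bounds(2) digit_mem EP that by blast
      have "finite D"
      proof (rule finite_subset)
        show "D \<subseteq> {..nat \<lfloor>digit_max n\<rfloor>}" using dmax by (auto simp: D_def le_nat_floor)
      qed simp
      have "D \<noteq> {}" using n by (auto simp: D_def)
      obtain \<omega> where \<omega>: "\<omega> \<in> E" "digit \<omega> n = Min D"
        using Min_in[OF \<open>finite D\<close> \<open>D \<noteq> {}\<close>] by (auto simp: D_def)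
      obtain \<omega>' where \<omega>': "\<omega>' \<in> E" "digit \<omega>' n = Max D"
        using Max_in[OF \<open>finite D\<close> \<open>D \<noteq> {}\<close>] by (auto simp: D_def)
      have minmax: "digit \<omega>'' n \<in> {digit \<omega> n..digit \<omega>' n}" if "\<omega>'' \<in> E" for \<omega>''
        unfolding \<omega>(2) \<omega>'(2) using that \<open>finite D\<close> by (auto simp: D_def)
      have less: "digit \<omega> n < digit \<omega>' n"
        using n minmax by (metis atLeastAtMost_iff le_antisym linorder_not_less order_trans)
      define m m' where "m = real (digit \<omega> n)" and "m' = real (digit \<omega>' n)"
      define Q where "Q = (\<Prod>k<n. (real (digit \<omega> k) + 1)\<^sup>2)"
      define q where "q = (\<Prod>k<n. real (digit \<omega> k))"
      have mm: "m \<ge> 1" "m' \<ge> m + 1" using less digit_ge(2)[of \<omega>] \<omega>(1) EP by (auto simp: m_def m'_def)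
      have Q: "Q > 0" unfolding Q_def by (intro prod_pos) (auto intro!: add_nonneg_pos)
      have q: "q > 0" unfolding q_def using digit_ge(2)[of \<omega>] \<omega>(1) EP
        by (intro prod_pos) (auto simp: Suc_le_eq subset_iff)
      have Qq: "Q \<le> prod_bound * q\<^sup>2" unfolding Q_def q_def using \<omega>(1) EP by (intro prod_Suc_digit_le) auto
      have "(m' - m) / (8 * m * m') / Q \<le> \<bar>rcf \<omega> - rcf \<omega>'\<bar>"
        unfolding m_def m'_def Q_def
        by (rule dist_rcf_ge) (use \<omega>(1) \<omega>'(1) EP less same[OF \<omega>(1) \<omega>'(1)] in \<open>auto simp only: subset_iff\<close>)
      also have "\<dots> \<le> v - u" using \<omega>(1) \<omega>'(1) by (auto simp: E_def abs_le_iff)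
      finally have dist: "(m' - m) / (8 * m * m') / Q \<le> v - u" .
      have "n \<ge> N"
      proof (rule ccontr)
        assume "\<not> n \<ge> N"
        have "Q * (m * m') \<le> R n * (digit_max n + 1)\<^sup>2"
        proof (rule mult_mono)
          show "Q \<le> R n" unfolding Q_def R_def using dmax[OF \<omega>(1)]
            by (intro prod_mono conjI power_mono) auto
          have "m * m' \<le> (digit_max n + 1) * (digit_max n + 1)"
            using mm dmax[OF \<omega>(1), of n] dmax[OF \<omega>'(1), of n]
            by (intro mult_mono) (auto simp: m_def m'_def)
          thus "m * m' \<le> (digit_max n + 1)\<^sup>2" by (simp add: power2_eq_square)
        qed (use less_imp_le[OF R_pos] mm in auto)
        also have "\<dots> = R (Suc n)" by (simp add: R_def)
        also have "\<dots> \<le> R N" using \<open>\<not> n \<ge> N\<close> by (intro R_mono) auto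
        finally have "Q * (m * m') \<le> R N" .
        have "\<delta> < 1 / (8 * R N)" using R_pos[of N] by (simp add: \<delta>_def divide_simps)
        also have "\<dots> \<le> (m' - m) / (8 * (Q * (m * m')))"
          using \<open>Q * (m * m') \<le> R N\<close> mm Q R_pos[of N] by (intro frac_le) auto
        also have "\<dots> = (m' - m) / (8 * m * m') / Q" by (simp add: mult_ac)
        finally show False using dist uv by simp
      qed
      define p where "p = measure (choice_measure (n, state \<omega> n \<le> target n))
        ({digit \<omega> n..digit \<omega>' n} \<inter> digits n (state \<omega> n \<le> target n))"
      have p0: "p \<ge> 0" by (simp add: p_def)
      have p1: "p \<le> 1" unfolding p_def by (rule prob_space.prob_le_1[OF prob_space_choice_measure])
      have p2: "p \<le> 2 * (m' - m) / m"
      proof -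
        have "p \<le> w n * (\<Sum>j\<in>{digit \<omega> n..digit \<omega>' n} \<inter> digits n (state \<omega> n \<le> target n). 1 / real j)"
          unfolding p_def by (rule measure_choice_measure_le) auto
        also have "\<dots> \<le> 1 * (\<Sum>j\<in>{digit \<omega> n..digit \<omega>' n} \<inter> digits n (state \<omega> n \<le> target n). 1 / real j)"
          using N[OF \<open>n \<ge> N\<close>] by (intro mult_right_mono sum_nonneg) auto
        also have "\<dots> \<le> 1 * (\<Sum>j\<in>{digit \<omega> n..digit \<omega>' n}. 1 / real j)"
          by (intro mult_left_mono sum_mono2) auto
        also have "\<dots> \<le> 1 * (\<Sum>j\<in>{digit \<omega> n..digit \<omega>' n}. 1 / m)"
          using mm by (intro mult_left_mono sum_mono divide_left_mono) (auto simp: m_def)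
        also have "\<dots> = (m' - m + 1) / m" using less by (simp add: m_def m'_def)
        \<comment> \<open>The endpoints are distinct integers, so their number m' - m + 1 is at most
          twice the gap.\<close>
        also have "\<dots> \<le> 2 * (m' - m) / m" using mm by (intro divide_right_mono) auto
        finally show ?thesis .
      qed
      \<comment> \<open>The two bounds on p combine into one of square-root type: for a gap of at
        least m the bound 1 suffices, otherwise squaring gains the factor (m' - m)/m < 1.\<close>
      have psq: "p\<^sup>2 \<le> 4 * (m' - m) / m"
      proof (cases "m' - m \<ge> m")
        case True
        have "p\<^sup>2 \<le> 1" using p0 p1 by (simp add: power_le_one)
        also have "1 \<le> 4 * (m' - m) / m" using True mm by (simp add: field_simps)
        finally show ?thesis .
      next
        case False
        have sq: "(2 * r / m)\<^sup>2 = (4 * r / m) * (r / m)" for r by (simp add: power2_eq_square)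
        have "p\<^sup>2 \<le> (2 * (m' - m) / m)\<^sup>2" using p0 p2 by (intro power_mono)
        also have "\<dots> = (4 * (m' - m) / m) * ((m' - m) / m)" by (rule sq)
        also have "\<dots> \<le> (4 * (m' - m) / m) * 1" using False mm by (intro mult_left_mono) auto
        finally show ?thesis by simp
      qed
      have "measure P E \<le> (\<Prod>k<n. w k / real (digit \<omega> k)) * p"
        unfolding p_def
        by (rule measure_cylinder_le[OF _ EP same[OF _ \<omega>(1)] minmax]) (use \<omega>(1) EP in auto)
      also have "(\<Prod>k<n. w k / real (digit \<omega> k)) = (\<Prod>k<n. w k) / q" by (simp add: q_def prod_dividef)
      finally have "(measure P E)\<^sup>2 \<le> ((\<Prod>k<n. w k) / q * p)\<^sup>2" by (intro power_mono) auto
      also have "\<dots> = (\<Prod>k<n. w k)\<^sup>2 * (1 / q\<^sup>2) * p\<^sup>2" by (simp add: power_mult_distrib power_divide)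
      also have "\<dots> \<le> (\<Prod>k<n. w k)\<^sup>2 * (prod_bound / Q) * (4 * (m' - m) / m)"
        using Qq q Q psq by (intro mult_mono mult_left_mono) (auto simp: field_simps prod_bound_def)
      \<comment> \<open>The distance bound is split off: 32 is 4 from \<open>psq\<close> times 8
        from the distance, and the factor m' left over is at most
        \<open>digit_max n\<close>.\<close>
      also have "\<dots> = 32 * prod_bound * ((\<Prod>k<n. w k)\<^sup>2 * m') * ((m' - m) / (8 * m * m') / Q)"
        using mm by simp
      also have "\<dots> \<le> 32 * prod_bound * ?V n * ((m' - m) / (8 * m * m') / Q)"
        using dmax[OF \<omega>'(1), of n] mm Q
        by (intro mult_right_mono mult_left_mono) (auto simp: m'_def prod_bound_def)
      also have "\<dots> \<le> e\<^sup>2 * (v - u)"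
        using N[OF \<open>n \<ge> N\<close>] dist mm Q by (intro mult_mono) auto
      finally have "(measure P E)\<^sup>2 \<le> (e * sqrt (v - u))\<^sup>2" using uv by (simp add: power_mult_distrib)
      hence "measure P E \<le> e * sqrt (v - u)" by (rule power2_le_imp_le) (use e uv in simp)
      thus ?thesis by (simp only: E_def)
    qed
  qed
  moreover have "\<delta> > 0" using R_pos by (simp add: \<delta>_def)
  ultimately show thesis using that by blast
qed

end

section \<open>The image measure and its comparison with the Hausdorff measure\<close>

context digit_data
begin

lemma a_at_top: "filterlim a at_top sequentially"
  unfolding filterlim_at_top
proof
  fix Z :: nat
  have "(\<lambda>n. 1 / real (a n)) \<longlonglongrightarrow> 0" by (rule summable_LIMSEQ_zero[OF summable_a])
  hence "eventually (\<lambda>n. 1 / real (a n) < 1 / real (Suc Z)) sequentially"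
    by (rule order_tendstoD(2)) simp
  thus "eventually (\<lambda>n. Z \<le> a n) sequentially"
  proof eventually_elim
    case (elim n)
    have "0 < real (a n)" using a_real_ge_1[of n] by linarith
    hence "real (Suc Z) < real (a n)" using elim by (simp add: divide_less_cancel frac_less2 field_simps)
    thus ?case by linarith
  qed
qed

lemma g_at_top: "filterlim g at_top sequentially"
  unfolding filterlim_at_top
proof
  fix Z :: real
  \<comment> \<open>If g were below Z, then ln a = g ln g would be at most Z^2, because ln g \<le> g
    - 1.\<close>
  have "eventually (\<lambda>n. nat \<lceil>exp (Z * Z)\<rceil> + 1 \<le> a n) sequentially"
    using a_at_top unfolding filterlim_at_top by blast
  thus "eventually (\<lambda>n. Z \<le> g n) sequentially"
  proof eventually_elim
    case (elim n)
    show ?case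
    proof (rule ccontr)
      assume "\<not> Z \<le> g n"
      hence "g n * ln (g n) \<le> Z * Z"
        using g_ge_1[of n] ln_le_minus_one[of "g n"] by (intro mult_mono) auto
      hence "real (a n) \<le> exp (Z * Z)"
        unfolding g_ln using a_real_ge_1[of n] by (subst (asm) exp_le_cancel_iff[symmetric]) simp
      thus False using elim by linarith
    qed
  qed
qed

lemma w_eventually_le: "eventually (\<lambda>n. w n \<le> 4 / g n) sequentially"
proof -
  have "eventually (\<lambda>n. 3 \<le> g n) sequentially" using g_at_top unfolding filterlim_at_top by blast
  thus ?thesis by eventually_elim (rule w_le)
qed

lemma w_eventually_le_1: "eventually (\<lambda>n. w n \<le> 1) sequentially"
proof -
  have "eventually (\<lambda>n. 4 \<le> g n) sequentially" using g_at_top unfolding filterlim_at_top by blast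
  with w_eventually_le show ?thesis
  proof eventually_elim
    case (elim n)
    have "4 / g n \<le> 1" using elim(2) by simp
    with elim(1) show ?case by linarith
  qed
qed

definition \<nu> :: "real measure" where
  "\<nu> = distr P (restrict_space borel (cf_set a)) rcf"

lemma measurable_rcf_restrict: "rcf \<in> P \<rightarrow>\<^sub>M restrict_space borel (cf_set a)"
  by (rule measurable_restrict_space2) (use rcf_mem measurable_rcf in auto)

lemma prob_space_\<nu>: "prob_space \<nu>"
  unfolding \<nu>_def by (rule prob_space.prob_space_distr[OF prob_space_P measurable_rcf_restrict])

lemma space_\<nu>: "space \<nu> = cf_set a"
  by (simp add: \<nu>_def space_restrict_space)

lemma cf_set_irrational: "cf_set a \<subseteq> {0..1} - \<rat>"
proof
  fix x assume "x \<in> cf_set a"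
  then obtain b where b: "x = cf_value b" "\<forall>n. b n \<ge> a n" by (auto simp: cf_set_def)
  have "\<forall>n. b n \<ge> 1" using b(2) a_ge_1 by (meson order_trans)
  thus "x \<in> {0..1} - \<rat>" unfolding b(1) by (rule cf_value_mem)
qed

lemma AE_\<nu>_limsup:
  "AE x in \<nu>. limsup (\<lambda>n. ereal
     ((\<Sum>k<n. (ln (real (partial_quotients x k) / real (a k)) / g k - 1)) / target n)) = 1"
proof -
  note [measurable] = measurable_partial_quotients[OF cf_set_irrational]
  \<comment> \<open>Measurability of the event is what allows the almost sure statement to be pulled
    back along \<open>rcf\<close>.\<close>
  have "{x \<in> space (restrict_space borel (cf_set a)). limsup (\<lambda>n. ereal
     ((\<Sum>k<n. (ln (real (partial_quotients x k) / real (a k)) / g k - 1)) / target n)) = 1}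
    \<in> sets (restrict_space borel (cf_set a))"
    by measurable
  moreover have "limsup (\<lambda>n. ereal ((\<Sum>k<n. (ln (real (partial_quotients (rcf \<omega>) k) / real (a k)) / g k - 1))
      / target n)) = 1" if "\<omega> \<in> space P" for \<omega>
  proof -
    have pq: "partial_quotients (rcf \<omega>) = digit \<omega>"
      unfolding rcf_def by (rule partial_quotients_cf_value) (rule digit_ge(2)[OF that])
    have "(\<lambda>n. ereal ((\<Sum>k<n. (ln (real (digit \<omega> k) / real (a k)) / g k - 1)) / target n)) \<longlonglongrightarrow> ereal 1"
      by (intro tendsto_intros digit_ratio_tendsto_1 that)
    from lim_imp_Limsup[OF trivial_limit_sequentially this] show ?thesis by (simp add: pq one_ereal_def)
  qed
  ultimately show ?thesis
    unfolding \<nu>_def by (subst AE_distr_iff[OF measurable_rcf_restrict]) (auto intro: AE_I2)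
qed

text \<open>The constant may be chosen arbitrarily small at the price of a smaller scale. Any one
  constant gives absolute continuity; letting c be small gives infinite measure.\<close>

lemma emeasure_\<nu>_le_premeasure:
  assumes null: "(\<lambda>n. (\<Prod>k<n. w k)\<^sup>2 * digit_max n) \<longlonglongrightarrow> 0" and c: "c > 0"
  obtains \<delta> where "\<delta> > 0"
    "\<And>A. A \<in> sets \<nu> \<Longrightarrow> emeasure \<nu> A \<le> ennreal c * hausdorff_premeasure (1/2) \<delta> A"
proof -
  obtain \<delta> where \<delta>: "\<delta> > 0"
    "\<And>u v. u \<le> v \<Longrightarrow> v - u \<le> \<delta> \<Longrightarrow> measure P {\<omega> \<in> space P. rcf \<omega> \<in> {u..v}} \<le> c * sqrt (v - u)"
    using rcf_interval_bound[OF null w_eventually_le_1 c] by blast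
  have sets: "{u..v} \<inter> space \<nu> \<in> sets \<nu>" for u v
  proof -
    have "cf_set a \<inter> {u..v} \<in> (\<inter>) (cf_set a) ` sets borel" by (rule imageI) simp
    thus ?thesis by (simp only: \<nu>_def sets_distr sets_restrict_space space_distr space_restrict_space
        space_borel Int_UNIV_right Int_commute[of "{u..v}"])
  qed
  have "emeasure \<nu> A \<le> ennreal c * hausdorff_premeasure (1/2) \<delta> A" if "A \<in> sets \<nu>" for A
  proof (rule emeasure_le_premeasure[OF _ c that sets])
    fix u v :: real assume uv: "u \<le> v" "v - u \<le> \<delta>"
    have "emeasure \<nu> ({u..v} \<inter> space \<nu>) = emeasure P (rcf -` ({u..v} \<inter> space \<nu>) \<inter> space P)"
      using sets[of u v] unfolding \<nu>_def by (intro emeasure_distr measurable_rcf_restrict) simp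
    also have "rcf -` ({u..v} \<inter> space \<nu>) \<inter> space P = {\<omega> \<in> space P. rcf \<omega> \<in> {u..v}}"
      using rcf_mem by (auto simp: space_\<nu>)
    also have "emeasure P \<dots> \<le> ennreal (c * (v - u) powr (1/2))"
      using \<delta>(2)[OF uv] uv by (simp add: finite_measure.emeasure_eq_measure[OF prob_space.finite_measure[OF prob_space_P]] powr_half_sqrt ennreal_leI)
    finally show "emeasure \<nu> ({u..v} \<inter> space \<nu>) \<le> ennreal (c * (v - u) powr (1/2))" .
  qed simp
  thus thesis using \<delta>(1) that by blast
qed

text \<open>If the value were a finite r, the choice c = 1/(r + 1) would bound the total mass 1 by c
  r < 1.\<close>

lemma hausdorff_outer_cf_set_infinite:
  assumes "(\<lambda>n. (\<Prod>k<n. w k)\<^sup>2 * digit_max n) \<longlonglongrightarrow> 0"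
  shows "hausdorff_outer (1/2) (cf_set a) = \<infinity>"
proof (rule ccontr)
  assume "hausdorff_outer (1/2) (cf_set a) \<noteq> \<infinity>"
  then obtain r where r: "r \<ge> 0" "hausdorff_outer (1/2) (cf_set a) = ennreal r"
    by (cases "hausdorff_outer (1/2) (cf_set a)") auto
  define c where "c = 1 / (r + 1)"
  have c: "c > 0" "c * r < 1" using r by (auto simp: c_def)
  obtain \<delta> where \<delta>: "\<delta> > 0"
    "\<And>A. A \<in> sets \<nu> \<Longrightarrow> emeasure \<nu> A \<le> ennreal c * hausdorff_premeasure (1/2) \<delta> A"
    using emeasure_\<nu>_le_premeasure[OF assms c(1)] by blast
  have "1 = emeasure \<nu> (cf_set a)"
    using prob_space.emeasure_space_1[OF prob_space_\<nu>] by (simp add: space_\<nu>)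
  also have "\<dots> \<le> ennreal c * hausdorff_premeasure (1/2) \<delta> (cf_set a)"
    using sets.top[of \<nu>] by (intro \<delta>(2)) (simp add: space_\<nu>)
  also have "\<dots> \<le> ennreal c * ennreal r"
    unfolding r(2)[symmetric] by (intro mult_left_mono hausdorff_premeasure_le_outer \<delta>(1)) auto
  also have "\<dots> = ennreal (c * r)" using r c by (simp add: ennreal_mult)
  also have "\<dots> < 1" using c(2) by (simp add: ennreal_less_one_iff)
  finally show False by simp
qed

lemma absolutely_continuous_\<nu>:
  assumes "(\<lambda>n. (\<Prod>k<n. w k)\<^sup>2 * digit_max n) \<longlonglongrightarrow> 0" "cf_set a \<in> sets borel"
  shows "absolutely_continuous (restrict_space (hausdorff_measure (1/2)) (cf_set a)) \<nu>"
  unfolding absolutely_continuous_def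
proof
  fix N assume "N \<in> null_sets (restrict_space (hausdorff_measure (1/2)) (cf_set a))"
  hence N: "N \<subseteq> cf_set a" "N \<in> sets borel" "emeasure (hausdorff_measure (1/2)) N = 0"
    using assms(2) by (simp_all add: null_sets_restrict_space) (auto simp: null_sets_def)
  have sets: "N \<in> sets \<nu>" using N(1,2) assms(2) by (simp add: \<nu>_def sets_restrict_space_iff)
  obtain \<delta> where \<delta>: "\<delta> > 0"
    "\<And>A. A \<in> sets \<nu> \<Longrightarrow> emeasure \<nu> A \<le> ennreal 1 * hausdorff_premeasure (1/2) \<delta> A"
    using emeasure_\<nu>_le_premeasure[OF assms(1), of 1] by auto
  have "emeasure \<nu> N \<le> hausdorff_premeasure (1/2) \<delta> N" using \<delta>(2)[OF sets] by simp
  also have "\<dots> \<le> hausdorff_outer (1/2) N" by (rule hausdorff_premeasure_le_outer[OF \<delta>(1)])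
  also have "\<dots> = 0" using N(2,3) by (simp add: emeasure_hausdorff_measure)
  finally show "N \<in> null_sets \<nu>" using sets by auto
qed

lemma weights_null:
  assumes "(\<exists>l>1. (\<lambda>n. real (a n)) \<lless> (\<lambda>n. l ^ n)) \<or>
     (\<exists>l>1. \<exists>\<epsilon>>0. (\<lambda>n. l ^ n) \<lless> (\<lambda>n. real (a n)) \<and>
             (\<lambda>n. real (a n)) \<lless> (\<lambda>n. real n powr (real n * (1 - \<epsilon>))))"
  shows "(\<lambda>n. (\<Prod>k<n. w k)\<^sup>2 * digit_max n) \<longlonglongrightarrow> 0"
  using assms
proof (elim disjE exE conjE)
  fix l :: real assume "l > 1" "(\<lambda>n. real (a n)) \<lless> (\<lambda>n. l ^ n)"
  then obtain C where "\<And>n. n \<ge> 1 \<Longrightarrow> real (a n) \<le> C * l ^ n" by (auto simp: vinogradov_le_def)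
  thus ?thesis unfolding digit_max_def
    by (rule weights_null_exponential[OF a_real_ge_1 g_ge_1 g_ln g_at_top w_pos w_eventually_le _ \<open>l > 1\<close>])
next
  fix l \<epsilon> :: real assume l: "l > 1" and \<epsilon>: "\<epsilon> > 0"
    and "(\<lambda>n. l ^ n) \<lless> (\<lambda>n. real (a n))" "(\<lambda>n. real (a n)) \<lless> (\<lambda>n. real n powr (real n * (1 - \<epsilon>)))"
  then obtain C C' where C: "\<And>n. n \<ge> 1 \<Longrightarrow> l ^ n \<le> C * real (a n)"
    "\<And>n. n \<ge> 1 \<Longrightarrow> real (a n) \<le> C' * real n powr (real n * (1 - \<epsilon>))"
    by (auto simp: vinogradov_le_def)
  show ?thesis unfolding digit_max_def
    by (rule weights_null_superexponential[OF a_real_ge_1 g_ge_1 g_ln g_at_top w_pos w_eventually_le C(1) l C(2) \<epsilon>])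
qed

end

theorem theorem1p1:
  fixes \<alpha> :: real and \<gamma> :: "nat \<Rightarrow> real"
  assumes "\<alpha> \<in> {0..1} - \<rat>"
    and "summable (\<lambda>n. 1 / real (partial_quotients \<alpha> n))"
    and "\<And>n. \<gamma> n > 0"
    and "\<And>n. \<gamma> n * real (partial_quotients \<alpha> n) powr \<gamma> n = 1"
  shows "\<exists>\<nu> :: real measure.
    prob_space \<nu> \<and>
    sets \<nu> = sets (restrict_space borel (cf_bounded_below_set \<alpha>)) \<and>
    (AE x in \<nu>.
       limsup (\<lambda>n. ereal
         ((\<Sum>k<n. (\<gamma> k * ln (real (partial_quotients x k) / real (partial_quotients \<alpha> k)) - 1))
            / sqrt (2 * real n * ln (ln (real n))))) = 1) \<and>
    ((\<exists>l>1. real \<lless> (\<lambda>n. real (partial_quotients \<alpha> n)) \<and>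
             (\<lambda>n. real (partial_quotients \<alpha> n)) \<lless> (\<lambda>n. l ^ n)) \<or>
     (\<exists>l>1. \<exists>\<epsilon>>0. (\<lambda>n. l ^ n) \<lless> (\<lambda>n. real (partial_quotients \<alpha> n)) \<and>
             (\<lambda>n. real (partial_quotients \<alpha> n)) \<lless> (\<lambda>n. real n powr (real n * (1 - \<epsilon>))))
     \<longrightarrow>
     absolutely_continuous
       (restrict_space (hausdorff_measure (1/2)) (cf_bounded_below_set \<alpha>)) \<nu> \<and>
     hausdorff_dim (cf_bounded_below_set \<alpha>) = ereal (1/2) \<and>
     emeasure (hausdorff_measure (1/2)) (cf_bounded_below_set \<alpha>) = \<infinity>)"
proof -
  define a where "a = partial_quotients \<alpha>"
  \<comment> \<open>In terms of g = 1/\<gamma>, taking logarithms turns \<gamma> a^\<gamma> = 1 into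
    g ln g = ln a, and a^\<gamma> \<ge> 1 forces g \<ge> 1.\<close>
  interpret digit_data a "\<lambda>n. 1 / \<gamma> n"
  proof
    fix n
    show a: "a n \<ge> 1" unfolding a_def by (rule partial_quotients_ge_1[OF assms(1)])
    have \<gamma>: "\<gamma> n > 0" "\<gamma> n * real (a n) powr \<gamma> n = 1" using assms(3,4) by (auto simp: a_def)
    have "1 \<le> real (a n) powr \<gamma> n" using a \<gamma>(1) by (intro ge_one_powr_ge_zero) auto
    hence "\<gamma> n * 1 \<le> \<gamma> n * real (a n) powr \<gamma> n" using \<gamma>(1) by (intro mult_left_mono) auto
    thus "1 \<le> 1 / \<gamma> n" using \<gamma> by simp
    have "0 = ln (\<gamma> n * real (a n) powr \<gamma> n)" by (simp add: \<gamma>(2))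
    also have "\<dots> = ln (\<gamma> n) + \<gamma> n * ln (real (a n))" using a \<gamma>(1) by (simp add: ln_mult ln_powr)
    finally show "1 / \<gamma> n * ln (1 / \<gamma> n) = ln (real (a n))" using \<gamma>(1) by (simp add: ln_div field_simps)
    show "summable (\<lambda>n. 1 / real (a n))" unfolding a_def by (rule assms(2))
  qed
  have X: "cf_bounded_below_set \<alpha> = cf_set a"
    unfolding a_def cf_set_def by (rule cf_bounded_below_set_eq[OF assms(1)])
  have borel: "cf_set a \<in> sets borel" using borel_cf_bounded_below_set[of \<alpha>] by (simp add: X)
  show ?thesis
    unfolding X a_def[symmetric]
  proof (intro exI[of _ \<nu>] conjI impI)
    show "prob_space \<nu>" by (rule prob_space_\<nu>)
    show "sets \<nu> = sets (restrict_space borel (cf_set a))" by (simp add: \<nu>_def)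
    show "AE x in \<nu>. limsup (\<lambda>n. ereal ((\<Sum>k<n. (\<gamma> k * ln (real (partial_quotients x k) / real (a k)) - 1))
            / sqrt (2 * real n * ln (ln (real n))))) = 1"
      using AE_\<nu>_limsup by (simp add: target_def mult.commute)
  next
    assume growth: "(\<exists>l>1. real \<lless> (\<lambda>n. real (a n)) \<and> (\<lambda>n. real (a n)) \<lless> (\<lambda>n. l ^ n)) \<or>
     (\<exists>l>1. \<exists>\<epsilon>>0. (\<lambda>n. l ^ n) \<lless> (\<lambda>n. real (a n)) \<and>
             (\<lambda>n. real (a n)) \<lless> (\<lambda>n. real n powr (real n * (1 - \<epsilon>))))"
    have null: "(\<lambda>n. (\<Prod>k<n. w k)\<^sup>2 * digit_max n) \<longlonglongrightarrow> 0"
      by (rule weights_null) (use growth in blast)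
    show "absolutely_continuous (restrict_space (hausdorff_measure (1/2)) (cf_set a)) \<nu>"
      by (rule absolutely_continuous_\<nu>[OF null borel])
    have inf: "hausdorff_outer (1/2) (cf_set a) = \<infinity>"
      by (rule hausdorff_outer_cf_set_infinite[OF null])
    show "hausdorff_dim (cf_set a) = ereal (1/2)"
    proof (rule hausdorff_dim_eqI)
      show "hausdorff_outer s (cf_set a) = 0" if "s > 1/2" for s
        using a_ge_1 a_at_top that by (intro hausdorff_outer_cf_set_eq_0) auto
    qed (simp_all add: inf)
    show "emeasure (hausdorff_measure (1/2)) (cf_set a) = \<infinity>"
      using borel inf by (simp add: emeasure_hausdorff_measure)
  qed
qed

end
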